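(* Let $(X_1,X_2,X_3)$ have standard exponential margins and joint density $f$ given by the trivariate vine copula in which $C_{12}$ is an extreme value copula with exponent measure $V^{\{12\}}$, $C_{23}$ is an inverted extreme value copula with exponent measure $V^{\{23\}}$, and $C_{13|2}$ is an extreme value copula with exponent measure $V^{\{13|2\}}$. Assume the spectral densities satisfy the tail conditions in the context. Then the gauge function of $f$, for nonnegative $x_1,x_2,x_3$, is $$g(\mathbf x)=x_2+\left(1+s_2^{\{12\}}\right)(x_2-x_1)+\left(2+s_2^{\{13|2\}}\right)\left\{V^{\{23\}}(x_2^{-1},x_3^{-1})-x_2\right\}\quad\text{if }0\le x_1\le x_2,$$ and, if $0\le x_2<x_1$, $$g(\mathbf x)=x_2+\left(2+s_{\rm m}^{\{13|2\}}\right)\max\left\{\left(2+s_1^{\{12\}}\right)(x_1-x_2),V^{\{23\}}(x_2^{-1},x_3^{-1})-x_2\right\}-\left(1+s_{\rm m}^{\{13|2\}}\right)\min\left\{\left(2+s_1^{\{12\}}\right)(x_1-x_2),V^{\{23\}}(x_2^{-1},x_3^{-1})-x_2\right\},$$ where $s_{\rm m}^{\{13|2\}}=s_1^{\{13|2\}}$ if $\left(2+s_1^{\{12\}}\right)(x_1-x_2)\ge V^{\{23\}}(x_2^{-1},x_3^{-1})-x_2$ and $s_{\rm m}^{\{13|2\}}=s_2^{\{13|2\}}$ otherwise.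
   Context: The gauge function of $f$ is the function $g$, homogeneous of order 1, with $-\ln f(t\mathbf x)\sim tg(\mathbf x)$ as $t\to\infty$, where $\mathbf x=(x_1,x_2,x_3)$. Exponent measure: $V(x,y)=2\int_0^1\max\left(\frac wx,\frac{1-w}{y}\right)dH(w)$, $x,y>0$, where the spectral distribution $H$ is a probability distribution on $[0,1]$ with $\int_0^1w\,dH(w)=1/2$. The derivatives of $V$ with respect to the first, second and both arguments are assumed to exist. Reciprocals of $0$ are read as $\infty$, with $V$ then evaluated by the same integral. Tail conditions: $h^{\{12\}},h^{\{23\}},h^{\{13|2\}}$ denote the spectral densities (densities of $H$) of the three pair copula components; they place no mass on $\{0\}$ or $\{1\}$, and each satisfies $h^{\{\cdot\}}(w)\sim c_1^{\{\cdot\}}(1-w)^{s_1^{\{\cdot\}}}$ as $w\nearrow1$ and $h^{\{\cdot\}}(w)\sim c_2^{\{\cdot\}}w^{s_2^{\{\cdot\}}}$ as $w\searrow0$, for some $c_1^{\{\cdot\}},c_2^{\{\cdot\}}\in\mathbb{R}$ and $s_1^{\{\cdot\}},s_2^{\{\cdot\}}>-1$. Extreme value copula: $C(u,v)=\exp\left\{-V\left(\frac{-1}{\ln u},\frac{-1}{\ln v}\right)\right\}$. Inverted extreme value copula: $C(u,v)=u+v-1+\exp\left[-V\left\{\frac{-1}{\ln(1-u)},\frac{-1}{\ln(1-v)}\right\}\right]$. Density $c=\partial^2C/\partial u\,\partial v$. Trivariate vine: with $F_i(x)=1-e^{-x}$, $f_i(x)=e^{-x}$, $F_{1|2}(x_1|x_2)=\partial_2C_{12}\{F_1(x_1),F_2(x_2)\}$,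 $F_{3|2}(x_3|x_2)=\partial_1C_{23}\{F_2(x_2),F_3(x_3)\}$, $$f(\mathbf x)=f_1(x_1)f_2(x_2)f_3(x_3)\,c_{12}\{F_1(x_1),F_2(x_2)\}\,c_{23}\{F_2(x_2),F_3(x_3)\}\,c_{13|2}\{F_{1|2}(x_1|x_2),F_{3|2}(x_3|x_2)\}.$$
   Formalization: On the boundary, where f vanishes, g is only the continuous homogeneous extension; at x1=x2 the asymptotics assume h^{12} continuous and positive at 1/2; where (2+s1^{12})(x1-x2)=V^{23}-x2, h^{13|2} is assumed continuous and positive on (0,1); tail constants c are nonzero. *)

theory Defs
  imports "HOL-Probability.Probability" "HOL-Library.Landau_Symbols"
begin

section \<open>Spectral distributions and exponent measures\<close>

definition spectral_distribution :: "real measure \<Rightarrow> bool" where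
  "spectral_distribution H \<longleftrightarrow>
     prob_space H \<and> sets H = sets borel \<and> (AE w in H. w \<in> {0..1}) \<and> (\<integral>w. w \<partial>H) = 1 / 2"

definition spectral_density :: "real measure \<Rightarrow> (real \<Rightarrow> real) \<Rightarrow> bool" where
  "spectral_density H h \<longleftrightarrow>
     h \<in> borel_measurable borel \<and> (\<forall>w\<in>{0..1}. 0 \<le> h w) \<and>
     H = density lborel (\<lambda>w. ennreal (indicator {0..1} w * h w))"

text \<open>Since division by zero is zero, an argument \<open>inverse 0 = 0\<close> makes the corresponding
  entry of the maximum vanish. This is the value for an infinite argument, so
  \<open>exponent_measure H (inverse x) (inverse y)\<close> is correct for all \<open>x, y \<ge> 0\<close>.\<close>

definition exponent_measure :: "real measure \<Rightarrow> real \<Rightarrow> real \<Rightarrow> real" where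
  "exponent_measure H x y = 2 * (LINT w:{0..1}|H. max (w / x) ((1 - w) / y))"

definition exponent_derivatives_exist :: "(real \<Rightarrow> real \<Rightarrow> real) \<Rightarrow> bool" where
  "exponent_derivatives_exist V \<longleftrightarrow>
     (\<forall>x>0. \<forall>y>0.
        (\<lambda>a. V a y) differentiable (at x) \<and>
        (\<lambda>b. V x b) differentiable (at y) \<and>
        (\<lambda>a. deriv (\<lambda>b. V a b) y) differentiable (at x))"

text \<open>The constants must be nonzero for the asymptotic equivalences to determine the exponents:
  \<open>asymp_equiv\<close> also relates two functions that both vanish near the limit point.\<close>

definition tail_conditions :: "(real \<Rightarrow> real) \<Rightarrow> real \<Rightarrow> real \<Rightarrow> bool" where
  "tail_conditions h s1 s2 \<longleftrightarrow> s1 > -1 \<and> s2 > -1 \<and>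
     (\<exists>c1 c2. c1 \<noteq> 0 \<and> c2 \<noteq> 0 \<and>
        asymp_equiv h (at_left 1) (\<lambda>w. c1 * (1 - w) powr s1) \<and>
        asymp_equiv h (at_right 0) (\<lambda>w. c2 * w powr s2))"

section \<open>Copulas\<close>

text \<open>Both formulas are meant for \<open>0 < u < 1\<close> and \<open>0 < v < 1\<close>.\<close>

definition ev_copula :: "(real \<Rightarrow> real \<Rightarrow> real) \<Rightarrow> real \<Rightarrow> real \<Rightarrow> real" where
  "ev_copula V u v = exp (- V (-1 / ln u) (-1 / ln v))"

definition inverted_ev_copula :: "(real \<Rightarrow> real \<Rightarrow> real) \<Rightarrow> real \<Rightarrow> real \<Rightarrow> real" where
  "inverted_ev_copula V u v = u + v - 1 + exp (- V (-1 / ln (1 - u)) (-1 / ln (1 - v)))"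

definition partial1 :: "(real \<Rightarrow> real \<Rightarrow> real) \<Rightarrow> real \<Rightarrow> real \<Rightarrow> real" where
  "partial1 C u v = deriv (\<lambda>a. C a v) u"

definition partial2 :: "(real \<Rightarrow> real \<Rightarrow> real) \<Rightarrow> real \<Rightarrow> real \<Rightarrow> real" where
  "partial2 C u v = deriv (\<lambda>b. C u b) v"

definition copula_density :: "(real \<Rightarrow> real \<Rightarrow> real) \<Rightarrow> real \<Rightarrow> real \<Rightarrow> real" where
  "copula_density C = partial1 (partial2 C)"

definition exp_cdf :: "real \<Rightarrow> real" where
  "exp_cdf x = 1 - exp (- x)"

fun vine_density ::
  "(real \<Rightarrow> real \<Rightarrow> real) \<Rightarrow> (real \<Rightarrow> real \<Rightarrow> real) \<Rightarrow> (real \<Rightarrow> real \<Rightarrow> real) \<Rightarrow>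
   real \<times> real \<times> real \<Rightarrow> real" where
  "vine_density C12 C23 C13 (x1, x2, x3) =
     exp (- x1) * exp (- x2) * exp (- x3) *
     copula_density C12 (exp_cdf x1) (exp_cdf x2) *
     copula_density C23 (exp_cdf x2) (exp_cdf x3) *
     copula_density C13 (partial2 C12 (exp_cdf x1) (exp_cdf x2))
                        (partial1 C23 (exp_cdf x2) (exp_cdf x3))"

section \<open>Gauge functions\<close>

definition nonneg_orthant :: "(real \<times> real \<times> real) set" where
  "nonneg_orthant = {(x1, x2, x3). 0 \<le> x1 \<and> 0 \<le> x2 \<and> 0 \<le> x3}"

text \<open>The set \<open>D\<close> consists of the points at which the defining asymptotics are required to hold
  pointwise. The vine densities vanish on the boundary of the orthant, where \<open>- ln f\<close> is
  infinite, so \<open>D\<close> can at most be the open orthant; on the rest of the orthant the gauge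
  function is determined by continuity, provided \<open>D\<close> is dense.\<close>

definition gauge_function_on ::
  "(real \<times> real \<times> real) set \<Rightarrow> (real \<times> real \<times> real \<Rightarrow> real) \<Rightarrow>
   (real \<times> real \<times> real \<Rightarrow> real) \<Rightarrow> bool" where
  "gauge_function_on D f g \<longleftrightarrow>
     continuous_on nonneg_orthant g \<and>
     (\<forall>x\<in>nonneg_orthant. \<forall>r\<ge>0. g (r *\<^sub>R x) = r * g x) \<and>
     (\<forall>x\<in>D. asymp_equiv (\<lambda>t::real. - ln (f (t *\<^sub>R x))) at_top (\<lambda>t. t * g x))"

end

theory Submission
  imports Defs "HOL-Real_Asymp.Real_Asymp"
begin

text \<open>
  On the scale \<open>p = - ln u\<close>, \<open>q = - ln v\<close> an extreme value copula is \<open>exp (- l p q)\<close>, where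
  \<open>l p q = V (1 / p) (1 / q)\<close> is the stable tail dependence function. It is the maximum over
  \<open>v\<close> of the linear functions \<open>upper v * p + lower v * q\<close>, where \<open>upper v\<close> and \<open>lower v\<close> are twice
  the integrals of \<open>u * h u\<close> over \<open>[v, 1]\<close> and of \<open>(1 - u) * h u\<close> over \<open>[0, v]\<close>, and the maximum is
  attained at \<open>w = q / (p + q)\<close>. Hence its gradient is \<open>(upper w, lower w)\<close> and the copula density is
  \<open>exp (p + q - l p q) * kernel p q\<close>, where the kernel is
  \<open>upper w * lower w + 2 * h w * p * q / (p + q) ^ 3\<close> (\<open>ev_copula_density\<close>). The exponential factor
  tends to 1 as soon as \<open>p\<close> or \<open>q\<close> vanishes, as in the first and third pair, and there the decay is that of the kernel. The tail
  conditions make \<open>h\<close>, \<open>lower\<close>, \<open>upper\<close> and \<open>1 - lower\<close> comparable to powers near the end points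
  of \<open>[0, 1]\<close>. If \<open>p\<close> and \<open>q\<close> decay at exponential rates \<open>a\<close> and \<open>b\<close>, then \<open>w\<close> approaches
  0 at rate \<open>b - a\<close> or 1 at rate \<open>a - b\<close>, and the rate of the kernel can be computed
  (\<open>kernel_decay_less\<close>, \<open>kernel_decay_greater\<close>).

  Along the ray through \<open>(x1, x2, x3)\<close> the three factors of the vine behave as follows. In the first
  pair copula \<open>p\<close> and \<open>q\<close> decay at the rates \<open>x1\<close> and \<open>x2\<close>. The second is an extreme
  value copula at the survival probabilities, so that \<open>p\<close> and \<open>q\<close> are exactly \<open>t * x2\<close> and
  \<open>t * x3\<close>; by homogeneity its rate is \<open>l x2 x3 - x2 - x3\<close> and its conditional distribution
  function is \<open>1 - const * exp (- b * t)\<close> with \<open>b = l x2 x3 - x2\<close>. In the third pair copula \<open>q\<close>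
  therefore decays at rate \<open>b\<close>. There \<open>p\<close> is minus the logarithm of the conditional distribution
  function of the first pair: it neither grows nor decays exponentially if \<open>x1 \<le> x2\<close>, and it decays
  at rate \<open>a = (2 + s1) * (x1 - x2)\<close> if \<open>x2 < x1\<close>. The sign of \<open>a - b\<close> decides at which end
  point the spectral density of the third pair is evaluated, which is the origin of the two cases
  in the exponent of the gauge function. Adding the rates gives the theorem
  (\<open>vine_decay_le\<close>, \<open>vine_decay_gt\<close>).

  Two points need more than rates. If \<open>a = b\<close>, the spectral argument of the third pair must be kept
  away from both end points; this needs two-sided bounds by multiples of \<open>exp (- a * t)\<close>, and
  so these are proved for \<open>p\<close> and \<open>q\<close> instead of mere rates. Moreover the density that occurs in
  the kernel is the derivative of \<open>lower\<close>, which agrees with \<open>h\<close> only almost everywhere, whereas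
  the tail conditions speak about the values of \<open>h\<close>; local bounds for \<open>h\<close> pass to this
  derivative (\<open>dens_ge\<close>, \<open>dens_le\<close>), and no more than such bounds is used.
\<close>

section \<open>Functions comparable up to constants\<close>

text \<open>This is \<open>f \<in> \<Theta>[F](g)\<close> for eventually positive functions. Positivity is built in because
  logarithms and real powers of such functions are taken throughout.\<close>
definition comparable :: "'a filter \<Rightarrow> ('a \<Rightarrow> real) \<Rightarrow> ('a \<Rightarrow> real) \<Rightarrow> bool" where
  "comparable F f g \<longleftrightarrow> (\<exists>k>0. \<exists>K>0. \<forall>\<^sub>F x in F. 0 < g x \<and> k * g x \<le> f x \<and> f x \<le> K * g x)"

lemma comparableI:
  assumes "0 < k" "\<forall>\<^sub>F x in F. 0 < g x" "\<forall>\<^sub>F x in F. k * g x \<le> f x" "\<forall>\<^sub>F x in F. f x \<le> K * g x"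
  shows "comparable F f g"
proof -
  have "\<forall>\<^sub>F x in F. 0 < g x \<and> k * g x \<le> f x \<and> f x \<le> max K 1 * g x"
    using assms(2,3,4)
  proof eventually_elim
    case (elim x)
    then have "K * g x \<le> max K 1 * g x" by (intro mult_right_mono) auto
    with elim show ?case by linarith
  qed
  moreover have "0 < max K 1" by simp
  ultimately show ?thesis unfolding comparable_def using \<open>0 < k\<close> by blast
qed

lemma comparableE:
  assumes "comparable F f g"
  obtains k K where "0 < k" "0 < K" "\<forall>\<^sub>F x in F. 0 < g x" "\<forall>\<^sub>F x in F. k * g x \<le> f x"
    "\<forall>\<^sub>F x in F. f x \<le> K * g x" "\<forall>\<^sub>F x in F. 0 < f x"
proof -
  obtain k K where k: "0 < k" "0 < K" and ev: "\<forall>\<^sub>F x in F. 0 < g x \<and> k * g x \<le> f x \<and> f x \<le> K * g x"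
    using assms unfolding comparable_def by blast
  show ?thesis
    by (rule that[OF k]; rule eventually_mono[OF ev])
       (use k in \<open>auto intro: less_le_trans[OF mult_pos_pos]\<close>)
qed

lemma comparable_pos: "comparable F f g \<Longrightarrow> \<forall>\<^sub>F x in F. 0 < f x"
  by (elim comparableE)

lemma comparable_pos_right: "comparable F f g \<Longrightarrow> \<forall>\<^sub>F x in F. 0 < g x"
  by (elim comparableE)

lemma comparable_trans [trans]:
  assumes "comparable F f g" "comparable F g h"
  shows "comparable F f h"
proof -
  obtain k K where k: "0 < k" "0 < K" "\<forall>\<^sub>F x in F. k * g x \<le> f x" "\<forall>\<^sub>F x in F. f x \<le> K * g x"
    by (rule comparableE[OF assms(1)])
  obtain l L where l: "0 < l" "0 < L" "\<forall>\<^sub>F x in F. 0 < h x" "\<forall>\<^sub>F x in F. l * h x \<le> g x"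
    "\<forall>\<^sub>F x in F. g x \<le> L * h x"
    by (rule comparableE[OF assms(2)])
  show ?thesis
  proof (rule comparableI[of "k * l" _ _ _ "K * L"])
    show "\<forall>\<^sub>F x in F. k * l * h x \<le> f x" using k(3) l(4)
    proof eventually_elim
      case (elim x)
      then have "k * (l * h x) \<le> k * g x" using k by (intro mult_left_mono) auto
      with elim show ?case by (simp add: mult.assoc)
    qed
    show "\<forall>\<^sub>F x in F. f x \<le> K * L * h x" using k(4) l(5)
    proof eventually_elim
      case (elim x)
      then have "K * g x \<le> K * (L * h x)" using k by (intro mult_left_mono) auto
      with elim show ?case by (simp add: mult.assoc)
    qed
  qed (use k l in auto)
qed

lemma comparable_mult:
  assumes "comparable F f1 g1" "comparable F f2 g2"
  shows "comparable F (\<lambda>x. f1 x * f2 x) (\<lambda>x. g1 x * g2 x)"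
proof -
  obtain k K where k: "0 < k" "0 < K" "\<forall>\<^sub>F x in F. 0 < g1 x" "\<forall>\<^sub>F x in F. k * g1 x \<le> f1 x"
    "\<forall>\<^sub>F x in F. f1 x \<le> K * g1 x" "\<forall>\<^sub>F x in F. 0 < f1 x"
    by (rule comparableE[OF assms(1)])
  obtain l L where l: "0 < l" "0 < L" "\<forall>\<^sub>F x in F. 0 < g2 x" "\<forall>\<^sub>F x in F. l * g2 x \<le> f2 x"
    "\<forall>\<^sub>F x in F. f2 x \<le> L * g2 x" "\<forall>\<^sub>F x in F. 0 < f2 x"
    by (rule comparableE[OF assms(2)])
  show ?thesis
  proof (rule comparableI[of "k * l" _ _ _ "K * L"])
    show "\<forall>\<^sub>F x in F. k * l * (g1 x * g2 x) \<le> f1 x * f2 x" using k(3,4,6) l(3,4)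
    proof eventually_elim
      case (elim x)
      then have "(k * g1 x) * (l * g2 x) \<le> f1 x * f2 x"
        using k l by (intro mult_mono) auto
      then show ?case by (simp add: ac_simps)
    qed
    show "\<forall>\<^sub>F x in F. f1 x * f2 x \<le> K * L * (g1 x * g2 x)" using k(3,5) l(5,6)
    proof eventually_elim
      case (elim x)
      then have "f1 x * f2 x \<le> (K * g1 x) * (L * g2 x)"
        using k l by (intro mult_mono) auto
      then show ?case by (simp add: ac_simps)
    qed
    show "\<forall>\<^sub>F x in F. 0 < g1 x * g2 x" using k(3) l(3) by eventually_elim simp
  qed (use k l in auto)
qed

lemma comparable_inverse:
  assumes "comparable F f g"
  shows "comparable F (\<lambda>x. inverse (f x)) (\<lambda>x. inverse (g x))"
proof -
  obtain k K where k: "0 < k" "0 < K" "\<forall>\<^sub>F x in F. 0 < g x" "\<forall>\<^sub>F x in F. k * g x \<le> f x"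
    "\<forall>\<^sub>F x in F. f x \<le> K * g x" "\<forall>\<^sub>F x in F. 0 < f x"
    by (rule comparableE[OF assms(1)])
  show ?thesis
  proof (rule comparableI[of "inverse K" _ _ _ "inverse k"])
    show "\<forall>\<^sub>F x in F. inverse K * inverse (g x) \<le> inverse (f x)" using k(5,6)
    proof eventually_elim
      case (elim x)
      from le_imp_inverse_le[OF elim] show ?case by (simp add: inverse_mult_distrib)
    qed
    show "\<forall>\<^sub>F x in F. inverse (f x) \<le> inverse k * inverse (g x)" using k(3,4)
    proof eventually_elim
      case (elim x)
      from le_imp_inverse_le[OF elim(2)] elim k show ?case by (simp add: inverse_mult_distrib)
    qed
  qed (use k in \<open>auto elim: eventually_mono\<close>)
qed

lemma comparable_divide:
  assumes "comparable F f1 g1" "comparable F f2 g2"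
  shows "comparable F (\<lambda>x. f1 x / f2 x) (\<lambda>x. g1 x / g2 x)"
  using comparable_mult[OF assms(1) comparable_inverse[OF assms(2)]] by (simp add: divide_inverse)

lemma comparable_powr:
  assumes "comparable F f g"
  shows "comparable F (\<lambda>x. f x powr s) (\<lambda>x. g x powr s)"
proof -
  have *: "comparable F (\<lambda>x. f x powr s) (\<lambda>x. g x powr s)"
    if fg: "comparable F f g" and "0 \<le> s" for f g and s :: real
  proof -
    obtain k K where k: "0 < k" "0 < K" "\<forall>\<^sub>F x in F. 0 < g x" "\<forall>\<^sub>F x in F. k * g x \<le> f x"
      "\<forall>\<^sub>F x in F. f x \<le> K * g x" "\<forall>\<^sub>F x in F. 0 < f x"
      by (rule comparableE[OF fg])
    show ?thesis
    proof (rule comparableI[of "k powr s" _ _ _ "K powr s"])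
      show "\<forall>\<^sub>F x in F. k powr s * g x powr s \<le> f x powr s" using k(3,4)
      proof eventually_elim
        case (elim x)
        then show ?case using powr_mono2[OF \<open>0 \<le> s\<close> _ elim(2)] k by (simp add: powr_mult)
      qed
      show "\<forall>\<^sub>F x in F. f x powr s \<le> K powr s * g x powr s" using k(3,5,6)
      proof eventually_elim
        case (elim x)
        then show ?case using powr_mono2[OF \<open>0 \<le> s\<close> _ elim(2)] k by (simp add: powr_mult)
      qed
      show "\<forall>\<^sub>F x in F. 0 < g x powr s" using k(3) by eventually_elim simp
    qed (use k in auto)
  qed
  show ?thesis
  proof (cases "0 \<le> s")
    case True then show ?thesis using * assms by blast
  next
    case False
    then have "comparable F (\<lambda>x. inverse (f x powr -s)) (\<lambda>x. inverse (g x powr -s))"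
      by (intro comparable_inverse *[OF assms]) auto
    then show ?thesis by (simp add: powr_minus)
  qed
qed

lemma comparable_add_small:
  assumes fg: "comparable F f g" and nn: "\<forall>\<^sub>F x in F. 0 \<le> e x" and le: "\<forall>\<^sub>F x in F. e x \<le> C * g x"
  shows "comparable F (\<lambda>x. f x + e x) g"
proof -
  obtain k K where k: "0 < k" "0 < K" "\<forall>\<^sub>F x in F. 0 < g x" "\<forall>\<^sub>F x in F. k * g x \<le> f x"
    "\<forall>\<^sub>F x in F. f x \<le> K * g x" "\<forall>\<^sub>F x in F. 0 < f x"
    by (rule comparableE[OF fg])
  show ?thesis
  proof (rule comparableI[of k _ _ _ "K + C"])
    show "\<forall>\<^sub>F x in F. k * g x \<le> f x + e x" using k(4) nn by eventually_elim simp
    show "\<forall>\<^sub>F x in F. f x + e x \<le> (K + C) * g x"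
      using k(5) le by eventually_elim (simp add: distrib_right)
  qed (use k in auto)
qed

lemma comparable_compose:
  assumes "comparable G f g" "filterlim w G F"
  shows "comparable F (\<lambda>x. f (w x)) (\<lambda>x. g (w x))"
  using assms unfolding comparable_def by (blast dest: eventually_compose_filterlim)

lemma comparable_eventually_eq:
  assumes fg: "comparable F f g"
    and eq: "\<forall>\<^sub>F x in F. f x = f' x" "\<forall>\<^sub>F x in F. g x = g' x"
  shows "comparable F f' g'"
proof -
  obtain k K where k: "0 < k" "0 < K" "\<forall>\<^sub>F x in F. 0 < g x" "\<forall>\<^sub>F x in F. k * g x \<le> f x"
    "\<forall>\<^sub>F x in F. f x \<le> K * g x"
    by (rule comparableE[OF fg])
  from k(3-5) eq have "\<forall>\<^sub>F x in F. 0 < g' x \<and> k * g' x \<le> f' x \<and> f' x \<le> K * g' x"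
    by eventually_elim auto
  with k(1,2) show ?thesis unfolding comparable_def by (intro exI conjI)
qed

lemma tendsto_imp_comparable_1:
  assumes "(f \<longlongrightarrow> l) F" "0 < (l::real)"
  shows "comparable F f (\<lambda>_. 1)"
proof (rule comparableI[of "l/2" _ _ _ "2*l"])
  have "\<forall>\<^sub>F x in F. l/2 < f x" "\<forall>\<^sub>F x in F. f x < 2*l"
    using order_tendstoD(1)[OF assms(1), of "l/2"] order_tendstoD(2)[OF assms(1), of "2*l"] assms(2)
    by linarith+
  then show "\<forall>\<^sub>F x in F. l/2 * 1 \<le> f x" "\<forall>\<^sub>F x in F. f x \<le> 2*l*1"
    by (auto elim: eventually_mono)
qed (use assms in auto)

lemma comparable_neg_ln:
  assumes e: "filterlim e (at_right (0::real)) F"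
  shows "comparable F (\<lambda>x. - ln (1 - e x)) e"
proof -
  have "comparable (at_right 0) (\<lambda>y. - ln (1 - y)) (\<lambda>y::real. y)"
  proof (rule comparableI[of 1 _ _ _ 2])
    have ev: "\<forall>\<^sub>F y in at_right (0::real). 0 < y \<and> y < 1/2"
      by (intro eventually_conj eventually_at_right_less)
         (auto simp: eventually_at_right_field intro!: exI[of _ "1/2"])
    show "\<forall>\<^sub>F y in at_right (0::real). 0 < y" using ev by (auto elim: eventually_mono)
    show "\<forall>\<^sub>F y in at_right (0::real). 1 * y \<le> - ln (1 - y)" using ev
    proof eventually_elim
      case (elim y)
      then show ?case using ln_add_one_self_le_self2[of "-y"] by simp
    qed
    show "\<forall>\<^sub>F y in at_right (0::real). - ln (1 - y) \<le> 2 * y" using ev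
    proof eventually_elim
      case (elim y)
      then have "- ln (1 - y) = ln (inverse (1 - y))" by (simp add: ln_inverse)
      also have "\<dots> \<le> inverse (1 - y) - 1" using elim by (intro ln_le_minus_one) auto
      also have "\<dots> \<le> 2 * y" 
      proof -
        have "1 \<le> (1 + 2*y) * (1 - y)" using elim mult_nonneg_nonneg[of y "1-2*y"] by (simp add: algebra_simps)
        then show ?thesis using elim by (simp add: field_simps)
      qed
      finally show ?case .
    qed
  qed simp
  from comparable_compose[OF this e] show ?thesis .
qed

section \<open>Exponential rates of decay\<close>

definition exp_decay :: "(real \<Rightarrow> real) \<Rightarrow> real \<Rightarrow> bool" where
  "exp_decay f r \<longleftrightarrow> (\<forall>\<^sub>F t in at_top. 0 < f t) \<and> ((\<lambda>t. - ln (f t) / t) \<longlongrightarrow> r) at_top"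

lemma exp_decay_pos: "exp_decay f r \<Longrightarrow> \<forall>\<^sub>F t in at_top. 0 < f t"
  by (simp add: exp_decay_def)

lemma exp_decay_exp: "exp_decay (\<lambda>t. exp (- (c * t))) c"
proof -
  have "\<forall>\<^sub>F t in at_top. c = - ln (exp (- (c * t))) / t"
    using eventually_gt_at_top[of "0::real"] by eventually_elim simp
  then show ?thesis unfolding exp_decay_def
    by (auto intro: Lim_transform_eventually[OF tendsto_const])
qed

lemma exp_decay_eventually_eq:
  assumes f: "exp_decay f r" and eq: "\<forall>\<^sub>F t in at_top. f t = g t"
  shows "exp_decay g r"
proof -
  have "((\<lambda>t. - ln (g t) / t) \<longlongrightarrow> r) at_top"
    by (rule Lim_transform_eventually[of "\<lambda>t. - ln (f t) / t"])
       (use f eq in \<open>auto simp: exp_decay_def elim: eventually_mono\<close>)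
  moreover have "\<forall>\<^sub>F t in at_top. 0 < g t"
    using exp_decay_pos[OF f] eq by eventually_elim simp
  ultimately show ?thesis by (simp add: exp_decay_def)
qed

lemma exp_decay_mult:
  assumes "exp_decay f a" "exp_decay g b"
  shows "exp_decay (\<lambda>t. f t * g t) (a + b)"
proof -
  have pos: "\<forall>\<^sub>F t in at_top. 0 < f t" "\<forall>\<^sub>F t in at_top. 0 < g t"
    using assms by (simp_all add: exp_decay_def)
  have "((\<lambda>t. - ln (f t) / t + - ln (g t) / t) \<longlongrightarrow> a + b) at_top"
    using assms by (intro tendsto_add) (auto simp: exp_decay_def)
  moreover have "\<forall>\<^sub>F t in at_top. - ln (f t) / t + - ln (g t) / t = - ln (f t * g t) / t"
    using pos by eventually_elim (simp add: ln_mult add_divide_distrib diff_divide_distrib)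
  moreover have "\<forall>\<^sub>F t in at_top. 0 < f t * g t" using pos by eventually_elim simp
  ultimately show ?thesis unfolding exp_decay_def by (blast intro: Lim_transform_eventually)
qed

lemma exp_decay_powr:
  assumes "exp_decay f a"
  shows "exp_decay (\<lambda>t. f t powr s) (s * a)"
proof -
  have pos: "\<forall>\<^sub>F t in at_top. 0 < f t" using assms by (simp add: exp_decay_def)
  have "((\<lambda>t. s * (- ln (f t) / t)) \<longlongrightarrow> s * a) at_top"
    using assms by (intro tendsto_mult tendsto_const) (auto simp: exp_decay_def)
  moreover have "\<forall>\<^sub>F t in at_top. s * (- ln (f t) / t) = - ln (f t powr s) / t"
    using pos by eventually_elim (simp add: ln_powr)
  moreover have "\<forall>\<^sub>F t in at_top. 0 < f t powr s" using pos by eventually_elim simp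
  ultimately show ?thesis unfolding exp_decay_def by (blast intro: Lim_transform_eventually)
qed

lemma exp_decay_divide:
  assumes "exp_decay f a" "exp_decay g b"
  shows "exp_decay (\<lambda>t. f t / g t) (a - b)"
proof -
  have "exp_decay (\<lambda>t. f t * g t powr -1) (a + -1 * b)"
    by (intro exp_decay_mult exp_decay_powr assms)
  moreover have "\<forall>\<^sub>F t in at_top. f t * g t powr -1 = f t / g t"
    using exp_decay_pos[OF assms(2)] by eventually_elim (simp add: powr_minus divide_inverse)
  ultimately have "exp_decay (\<lambda>t. f t / g t) (a + -1 * b)" by (rule exp_decay_eventually_eq)
  then show ?thesis by simp
qed

lemma exp_decay_power:
  assumes "exp_decay f a"
  shows "exp_decay (\<lambda>t. f t ^ n) (real n * a)"
  by (rule exp_decay_eventually_eq[OF exp_decay_powr[OF assms]])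
    (use exp_decay_pos[OF assms] in \<open>auto simp: powr_realpow elim: eventually_mono\<close>)

lemma exp_decay_comparable:
  assumes "comparable at_top f g" "exp_decay g r"
  shows "exp_decay f r"
proof -
  obtain k K where k: "0 < k" "0 < K" "\<forall>\<^sub>F x in at_top. 0 < g x" "\<forall>\<^sub>F x in at_top. k * g x \<le> f x"
    "\<forall>\<^sub>F x in at_top. f x \<le> K * g x" "\<forall>\<^sub>F x in at_top. 0 < f x"
    by (rule comparableE[OF assms(1)])
  have lim: "((\<lambda>t. - ln c / t + - ln (g t) / t) \<longlongrightarrow> r) at_top" for c
  proof -
    have "((\<lambda>t. - ln c / t) \<longlongrightarrow> 0) at_top" by real_asymp
    from tendsto_add[OF this, of "\<lambda>t. - ln (g t) / t" r] assms(2) show ?thesis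
      unfolding exp_decay_def by (simp only: add_0)
  qed
  have "((\<lambda>t. - ln (f t) / t) \<longlongrightarrow> r) at_top"
  proof (rule real_tendsto_sandwich[OF _ _ lim[of K] lim[of k]])
    show "\<forall>\<^sub>F t in at_top. - ln K / t + - ln (g t) / t \<le> - ln (f t) / t"
      using k(3,5,6) eventually_gt_at_top[of "0::real"]
    proof eventually_elim
      case (elim t)
      then have "ln (f t) \<le> ln K + ln (g t)"
        using k(2) by (subst ln_mult_pos[symmetric]) auto
      with elim show ?case by (simp add: divide_simps)
    qed
    show "\<forall>\<^sub>F t in at_top. - ln (f t) / t \<le> - ln k / t + - ln (g t) / t"
      using k(3,4,6) eventually_gt_at_top[of "0::real"]
    proof eventually_elim
      case (elim t)
      then have "ln k + ln (g t) \<le> ln (f t)"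
        using k(1) by (subst ln_mult_pos[symmetric]) auto
      with elim show ?case by (simp add: divide_simps)
    qed
  qed
  with k(6) show ?thesis by (simp add: exp_decay_def)
qed

lemma exp_decay_comparable_1: "comparable at_top f (\<lambda>_. 1) \<Longrightarrow> exp_decay f 0"
  using exp_decay_exp[of 0] by (auto intro: exp_decay_comparable)

lemma exp_decay_tendsto: "(f \<longlongrightarrow> l) at_top \<Longrightarrow> 0 < l \<Longrightarrow> exp_decay f 0"
  by (intro exp_decay_comparable_1 tendsto_imp_comparable_1)

text \<open>A sum lies between the maximum of its two terms and twice the maximum, so the slower decay wins.\<close>
lemma exp_decay_add:
  assumes "exp_decay f a" "exp_decay g b"
  shows "exp_decay (\<lambda>t. f t + g t) (min a b)"
proof -
  have pos: "\<forall>\<^sub>F t in at_top. 0 < f t" "\<forall>\<^sub>F t in at_top. 0 < g t"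
    using assms by (simp_all add: exp_decay_def)
  have "((\<lambda>t. min (- ln (f t) / t) (- ln (g t) / t)) \<longlongrightarrow> min a b) at_top"
    using assms by (intro tendsto_min) (auto simp: exp_decay_def)
  moreover have "\<forall>\<^sub>F t in at_top. min (- ln (f t) / t) (- ln (g t) / t) = - ln (max (f t) (g t)) / t"
    using pos eventually_gt_at_top[of "0::real"]
  proof eventually_elim
    case (elim t)
    then show ?case by (auto simp: max_def min_def divide_simps)
  qed
  moreover have "\<forall>\<^sub>F t in at_top. 0 < max (f t) (g t)" using pos by eventually_elim simp
  ultimately have "exp_decay (\<lambda>t. max (f t) (g t)) (min a b)"
    unfolding exp_decay_def by (blast intro: Lim_transform_eventually)
  moreover have "comparable at_top (\<lambda>t. f t + g t) (\<lambda>t. max (f t) (g t))"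
  proof (rule comparableI[of 1 _ _ _ 2])
    show "\<forall>\<^sub>F t in at_top. 0 < max (f t) (g t)" using pos by eventually_elim simp
    show "\<forall>\<^sub>F t in at_top. 1 * max (f t) (g t) \<le> f t + g t" using pos by eventually_elim simp
    show "\<forall>\<^sub>F t in at_top. f t + g t \<le> 2 * max (f t) (g t)" using pos by eventually_elim simp
  qed simp
  ultimately show ?thesis by (rule exp_decay_comparable[rotated])
qed

lemma exp_decay_filterlim:
  assumes "exp_decay f r" "0 < r"
  shows "filterlim f (at_right 0) at_top"
proof -
  have pos: "\<forall>\<^sub>F t in at_top. 0 < f t" using assms by (simp add: exp_decay_def)
  have "\<forall>\<^sub>F t in at_top. r/2 < - ln (f t) / t"
    by (rule order_tendstoD(1)[of _ r]) (use assms in \<open>auto simp: exp_decay_def\<close>)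
  then have le: "\<forall>\<^sub>F t in at_top. f t \<le> exp (- (r/2 * t))"
    using pos eventually_gt_at_top[of "0::real"]
  proof eventually_elim
    case (elim t)
    then have "ln (f t) \<le> - (r/2*t)" by (simp add: field_simps)
    with elim show ?case by (metis exp_ln exp_le_cancel_iff)
  qed
  have "((\<lambda>t. exp (- (r/2 * t))) \<longlongrightarrow> 0) at_top"
    using \<open>0 < r\<close> by real_asymp
  moreover have "\<forall>\<^sub>F t in at_top. 0 \<le> f t" using pos by eventually_elim simp
  ultimately have "(f \<longlongrightarrow> 0) at_top" using tendsto_sandwich[OF _ le tendsto_const] by blast
  with pos show ?thesis by (auto simp: filterlim_at elim: eventually_mono)
qed

lemma exp_decay_compose:
  assumes "comparable (at_right 0) \<phi> (\<lambda>w. w powr s)" "exp_decay w r" "0 < r"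
  shows "exp_decay (\<lambda>t. \<phi> (w t)) (s * r)"
  using comparable_compose[OF assms(1) exp_decay_filterlim[OF assms(2,3)]]
  by (rule exp_decay_comparable) (intro exp_decay_powr assms)

text \<open>If \<open>f\<close> decays exponentially, then \<open>- ln f\<close> grows linearly, which is invisible at the
  exponential scale.\<close>
lemma exp_decay_neg_ln:
  assumes "exp_decay f r" "0 < r"
  shows "exp_decay (\<lambda>t. - ln (f t)) 0"
proof -
  have "((\<lambda>t. - ln t / t) \<longlongrightarrow> (0::real)) at_top" by real_asymp
  then have "exp_decay (\<lambda>t. t) 0"
    by (simp add: exp_decay_def eventually_gt_at_top)
  moreover have "exp_decay (\<lambda>t. - ln (f t) / t) 0"
    using assms by (intro exp_decay_tendsto[of _ r]) (auto simp: exp_decay_def)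
  ultimately have "exp_decay (\<lambda>t. - ln (f t) / t * t) (0 + 0)"
    by (intro exp_decay_mult)
  moreover have "\<forall>\<^sub>F t in at_top. - ln (f t) / t * t = - ln (f t)"
    using eventually_gt_at_top[of "0::real"] by eventually_elim simp
  ultimately have "exp_decay (\<lambda>t. - ln (f t)) (0 + 0)" by (rule exp_decay_eventually_eq)
  then show ?thesis by simp
qed

section \<open>Spectral integrals and the stable tail dependence function\<close>

locale spectral =
  fixes H :: "real measure" and h :: "real \<Rightarrow> real"
  assumes distribution: "spectral_distribution H" and density: "spectral_density H h"
begin

lemma h_nonneg: "0 \<le> w \<Longrightarrow> w \<le> 1 \<Longrightarrow> 0 \<le> h w"
  using density by (auto simp: spectral_density_def)

lemma h_measurable [measurable]: "h \<in> borel_measurable borel"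
  using density by (auto simp: spectral_density_def)

lemma H_eq: "H = density lborel (\<lambda>w. ennreal (indicator {0..1} w * h w))"
  using density by (auto simp: spectral_density_def)

lemma ind_h_nonneg: "0 \<le> indicator {0..1} w * h w"
  using h_nonneg[of w] by (auto simp: indicator_def)

lemma integrable_h: "integrable lborel (\<lambda>w. indicator {0..1} w * h w)"
proof -
  have "emeasure H (space H) = 1"
    using distribution by (intro prob_space.emeasure_space_1) (simp add: spectral_distribution_def)
  then have "(\<integral>\<^sup>+ w. ennreal (indicator {0..1} w * h w) \<partial>lborel) = 1"
    unfolding H_eq by (simp add: emeasure_density)
  then show ?thesis
    by (intro integrableI_nonneg) (auto simp: ind_h_nonneg)
qed

lemma set_integrable_mult_h:
  assumes [measurable]: "\<phi> \<in> borel_measurable borel" and B: "\<And>w. w \<in> {0..1} \<Longrightarrow> \<bar>\<phi> w\<bar> \<le> B"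
  shows "set_integrable lborel {0..1} (\<lambda>w. \<phi> w * h w)"
  unfolding set_integrable_def
proof (rule Bochner_Integration.integrable_bound)
  show "integrable lborel (\<lambda>w. B * (indicator {0..1} w * h w))"
    using integrable_h by simp
  have "norm (indicator {0..1} w *\<^sub>R (\<phi> w * h w)) \<le> norm (B * (indicator {0..1} w * h w))" for w
    using B[of w] h_nonneg[of w]
    by (auto simp: indicator_def abs_mult intro!: mult_right_mono order_trans[OF B[of w] abs_ge_self])
  then show "AE w in lborel. norm (indicator {0..1} w *\<^sub>R (\<phi> w * h w)) \<le> norm (B * (indicator {0..1} w * h w))"
    by simp
qed simp

lemma integrable_mult_h:
  assumes "\<phi> \<in> borel_measurable borel" "\<And>w. w \<in> {0..1} \<Longrightarrow> \<bar>\<phi> w\<bar> \<le> B" "0 \<le> a" "b \<le> 1"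
  shows "(\<lambda>w. \<phi> w * h w) integrable_on {a..b}"
  using set_borel_integral_eq_integral(1)[OF set_integrable_mult_h[OF assms(1,2)]] assms(3,4)
  by (auto intro: integrable_on_subinterval)

lemma LINT_H:
  assumes [measurable]: "\<phi> \<in> borel_measurable borel" and B: "\<And>w. w \<in> {0..1} \<Longrightarrow> \<bar>\<phi> w\<bar> \<le> B"
  shows "(LINT w:{0..1}|H. \<phi> w) = integral {0..1} (\<lambda>w. \<phi> w * h w)"
proof -
  have "(LINT w:{0..1}|H. \<phi> w)
    = (LINT w|lborel. (indicator {0..1} w * h w) *\<^sub>R (indicator {0..1} w *\<^sub>R \<phi> w))"
    unfolding set_lebesgue_integral_def H_eq
    by (rule integral_density) (auto simp: ind_h_nonneg)
  also have "\<dots> = (LINT w:{0..1}|lborel. \<phi> w * h w)"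
    unfolding set_lebesgue_integral_def by (rule Bochner_Integration.integral_cong) (auto simp: indicator_def)
  also have "\<dots> = integral {0..1} (\<lambda>w. \<phi> w * h w)"
    by (rule set_borel_integral_eq_integral(2)[OF set_integrable_mult_h[OF assms]])
  finally show ?thesis .
qed

lemma LINT_H_UNIV:
  assumes [measurable]: "\<phi> \<in> borel_measurable borel"
  shows "(LINT w|H. \<phi> w) = (LINT w:{0..1}|H. \<phi> w)"
proof -
  have "AE w in H. \<phi> w = indicator {0..1} w *\<^sub>R \<phi> w"
    using distribution unfolding spectral_distribution_def by (auto elim: AE_mp)
  moreover have "sets H = sets borel" by (simp add: H_eq)
  ultimately show ?thesis
    unfolding set_lebesgue_integral_def
    by (intro integral_cong_AE) (auto cong: measurable_cong_sets)
qed

lemma integral_h_mean: "integral {0..1} (\<lambda>w. w * h w) = 1/2"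
proof -
  have "integral {0..1} (\<lambda>w. w * h w) = (LINT w|H. w)"
    by (subst LINT_H[of _ 1, symmetric]) (auto simp: LINT_H_UNIV)
  then show ?thesis using distribution by (simp add: spectral_distribution_def)
qed

lemma integral_h: "integral {0..1} h = 1"
proof -
  have "integral {0..1} (\<lambda>w. 1 * h w) = (LINT w|H. 1)"
    by (simp only: LINT_H_UNIV[OF borel_measurable_const]) (rule LINT_H[of _ 1, symmetric]; simp)
  also have "\<dots> = 1"
    using distribution by (simp add: spectral_distribution_def prob_space.prob_space)
  finally show ?thesis by simp
qed

lemma integral_h_mean': "integral {0..1} (\<lambda>w. (1 - w) * h w) = 1/2"
proof -
  have "(\<lambda>w. 1 * h w) integrable_on {0..1}" "(\<lambda>w. w * h w) integrable_on {0..1}"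
    by (rule integrable_mult_h[of _ 1]; simp)+
  then show ?thesis
    using integral_h integral_h_mean by (simp add: left_diff_distrib integral_diff)
qed

text \<open>The two partial derivatives of the stable tail dependence function at \<open>(1 - w, w)\<close>.\<close>
definition upper :: "real \<Rightarrow> real" where "upper w = 2 * integral {w..1} (\<lambda>u. u * h u)"
definition lower :: "real \<Rightarrow> real" where "lower w = 2 * integral {0..w} (\<lambda>u. (1 - u) * h u)"

lemma integrable_uh: "0 \<le> a \<Longrightarrow> b \<le> 1 \<Longrightarrow> (\<lambda>u. u * h u) integrable_on {a..b}"
  by (rule integrable_mult_h[of _ 1]) auto

lemma integrable_ch: "0 \<le> a \<Longrightarrow> b \<le> 1 \<Longrightarrow> (\<lambda>u. (1 - u) * h u) integrable_on {a..b}"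
  by (rule integrable_mult_h[of _ 1]) auto

lemma upper_0: "upper 0 = 1" and lower_1: "lower 1 = 1"
  and upper_1: "upper 1 = 0" and lower_0: "lower 0 = 0"
  by (simp_all add: upper_def lower_def integral_h_mean integral_h_mean')

lemma lower_diff:
  assumes "0 \<le> v" "v \<le> w" "w \<le> 1"
  shows "lower w = lower v + 2 * integral {v..w} (\<lambda>u. (1 - u) * h u)"
proof -
  have "integral {0..w} (\<lambda>u. (1 - u) * h u)
    = integral {0..v} (\<lambda>u. (1 - u) * h u) + integral {v..w} (\<lambda>u. (1 - u) * h u)"
    using assms by (intro Henstock_Kurzweil_Integration.integral_combine[symmetric] integrable_ch) auto
  then show ?thesis by (simp add: lower_def)
qed

lemma upper_diff:
  assumes "0 \<le> v" "v \<le> w" "w \<le> 1"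
  shows "upper v = upper w + 2 * integral {v..w} (\<lambda>u. u * h u)"
proof -
  have "integral {v..1} (\<lambda>u. u * h u)
    = integral {v..w} (\<lambda>u. u * h u) + integral {w..1} (\<lambda>u. u * h u)"
    using assms by (intro Henstock_Kurzweil_Integration.integral_combine[symmetric] integrable_uh) auto
  then show ?thesis by (simp add: upper_def)
qed

lemma integral_ch_nonneg: "0 \<le> a \<Longrightarrow> b \<le> 1 \<Longrightarrow> 0 \<le> integral {a..b} (\<lambda>u. (1 - u) * h u)"
  by (intro integral_nonneg integrable_ch) (auto intro!: mult_nonneg_nonneg h_nonneg)

lemma integral_uh_nonneg: "0 \<le> a \<Longrightarrow> b \<le> 1 \<Longrightarrow> 0 \<le> integral {a..b} (\<lambda>u. u * h u)"
  by (intro integral_nonneg integrable_uh) (auto intro!: mult_nonneg_nonneg h_nonneg)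

lemma lower_mono: "0 \<le> v \<Longrightarrow> v \<le> w \<Longrightarrow> w \<le> 1 \<Longrightarrow> lower v \<le> lower w"
  using lower_diff[of v w] integral_ch_nonneg[of v w] by simp

lemma upper_antimono: "0 \<le> v \<Longrightarrow> v \<le> w \<Longrightarrow> w \<le> 1 \<Longrightarrow> upper w \<le> upper v"
  using upper_diff[of v w] integral_uh_nonneg[of v w] by simp

lemma lower_nonneg: "0 \<le> w \<Longrightarrow> w \<le> 1 \<Longrightarrow> 0 \<le> lower w"
  using integral_ch_nonneg[of 0 w] by (simp add: lower_def)

lemma upper_nonneg: "0 \<le> w \<Longrightarrow> w \<le> 1 \<Longrightarrow> 0 \<le> upper w"
  using integral_uh_nonneg[of w 1] by (simp add: upper_def)

lemma lower_le_1: "0 \<le> w \<Longrightarrow> w \<le> 1 \<Longrightarrow> lower w \<le> 1"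
  using lower_mono[of w 1] by (simp add: lower_1)

lemma upper_le_1: "0 \<le> w \<Longrightarrow> w \<le> 1 \<Longrightarrow> upper w \<le> 1"
  using upper_antimono[of 0 w] by (simp add: upper_0)

text \<open>The stable tail dependence function. At \<open>p = 0\<close> or \<open>q = 0\<close> the value \<open>inverse 0 = 0\<close> makes the
  corresponding entry of the maximum vanish, so that \<open>stdf_eq\<close> holds without restriction.\<close>
definition stdf :: "real \<Rightarrow> real \<Rightarrow> real" where
  "stdf p q = exponent_measure H (inverse p) (inverse q)"

lemma max_measurable: "(\<lambda>w::real. max (w * p) ((1 - w) * q)) \<in> borel_measurable borel"
  by (intro borel_measurable_max) auto

lemma max_bound:
  assumes "w \<in> {0..1::real}"
  shows "\<bar>max (w * p) ((1 - w) * q)\<bar> \<le> \<bar>p\<bar> + \<bar>q\<bar>"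
proof -
  have "\<bar>w * p\<bar> \<le> \<bar>p\<bar>" "\<bar>(1 - w) * q\<bar> \<le> \<bar>q\<bar>"
    using assms by (auto simp: abs_mult intro: mult_left_le_one_le)
  then show ?thesis by (auto simp: max_def)
qed

lemma integrable_max:
  "0 \<le> a \<Longrightarrow> b \<le> 1 \<Longrightarrow> (\<lambda>w. max (w * p) ((1 - w) * q) * h w) integrable_on {a..b}"
  by (rule integrable_mult_h[OF max_measurable max_bound])

lemma stdf_eq: "stdf p q = 2 * integral {0..1} (\<lambda>w. max (w * p) ((1 - w) * q) * h w)"
proof -
  have "w / inverse r = w * r" for w r :: real by (simp add: divide_inverse)
  then have "stdf p q = 2 * (LINT w:{0..1}|H. max (w * p) ((1 - w) * q))"
    unfolding stdf_def exponent_measure_def by presburger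
  then show ?thesis by (simp only: LINT_H[OF max_measurable max_bound])
qed

lemma stdf_split:
  assumes "0 \<le> v" "v \<le> 1"
  shows "stdf p q = 2 * integral {0..v} (\<lambda>w. max (w * p) ((1 - w) * q) * h w)
    + 2 * integral {v..1} (\<lambda>w. max (w * p) ((1 - w) * q) * h w)"
  unfolding stdf_eq
  by (subst Henstock_Kurzweil_Integration.integral_combine[OF assms integrable_max, symmetric]) auto

lemma stdf_ge:
  assumes "0 \<le> v" "v \<le> 1"
  shows "upper v * p + lower v * q \<le> stdf p q"
proof -
  have "integral {0..v} (\<lambda>w. (1 - w) * h w * q) \<le> integral {0..v} (\<lambda>w. max (w * p) ((1 - w) * q) * h w)"
  proof (intro integral_le integrable_max)
    show "(\<lambda>w. (1 - w) * h w * q) integrable_on {0..v}"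
      by (intro integrable_on_mult_left integrable_ch) (use assms in auto)
    show "(1 - w) * h w * q \<le> max (w * p) ((1 - w) * q) * h w" if "w \<in> {0..v}" for w
      using that assms mult_right_mono[of "(1-w)*q" "max (w * p) ((1 - w) * q)" "h w"]
      by (auto simp: h_nonneg ac_simps)
  qed (use assms in auto)
  moreover have "integral {v..1} (\<lambda>w. w * h w * p) \<le> integral {v..1} (\<lambda>w. max (w * p) ((1 - w) * q) * h w)"
  proof (intro integral_le integrable_max)
    show "(\<lambda>w. w * h w * p) integrable_on {v..1}"
      by (intro integrable_on_mult_left integrable_uh) (use assms in auto)
    show "w * h w * p \<le> max (w * p) ((1 - w) * q) * h w" if "w \<in> {v..1}" for w
      using that assms mult_right_mono[of "w*p" "max (w * p) ((1 - w) * q)" "h w"]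
      by (auto simp: h_nonneg ac_simps)
  qed (use assms in auto)
  ultimately show ?thesis
    unfolding stdf_split[OF assms] upper_def lower_def Henstock_Kurzweil_Integration.integral_mult_left
    by linarith
qed

lemma stdf_eq_upper_lower:
  assumes "0 < p" "0 < q"
  shows "stdf p q = upper (q / (p + q)) * p + lower (q / (p + q)) * q"
proof -
  let ?v = "q / (p + q)"
  have v: "0 \<le> ?v" "?v \<le> 1" using assms by auto
  have "integral {0..?v} (\<lambda>w. max (w * p) ((1 - w) * q) * h w) = integral {0..?v} (\<lambda>w. (1 - w) * h w * q)"
  proof (rule Henstock_Kurzweil_Integration.integral_cong)
    fix w assume "w \<in> {0..?v}"
    then have "w * p \<le> (1 - w) * q" using assms by (simp add: field_simps)
    then show "max (w * p) ((1 - w) * q) * h w = (1 - w) * h w * q" by simp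
  qed
  moreover have "integral {?v..1} (\<lambda>w. max (w * p) ((1 - w) * q) * h w) = integral {?v..1} (\<lambda>w. w * h w * p)"
  proof (rule Henstock_Kurzweil_Integration.integral_cong)
    fix w assume "w \<in> {?v..1}"
    then have "(1 - w) * q \<le> w * p" using assms by (simp add: field_simps)
    then show "max (w * p) ((1 - w) * q) * h w = w * h w * p" by simp
  qed
  ultimately show ?thesis
    unfolding stdf_split[OF v] upper_def lower_def by simp
qed

lemma stdf_ge_left: "p \<le> stdf p q" and stdf_ge_right: "q \<le> stdf p q"
  using stdf_ge[of 0 p q] stdf_ge[of 1 p q] by (simp_all add: upper_0 lower_1 upper_1 lower_0)

lemma stdf_le: "0 < p \<Longrightarrow> 0 < q \<Longrightarrow> stdf p q \<le> p + q"
  unfolding stdf_eq_upper_lower by (intro add_mono mult_left_le_one_le upper_nonneg lower_nonneg upper_le_1 lower_le_1) auto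

lemma stdf_homogeneous:
  assumes "0 \<le> r"
  shows "stdf (r * p) (r * q) = r * stdf p q"
proof -
  have "max (w * (r * p)) ((1 - w) * (r * q)) * h w = r * (max (w * p) ((1 - w) * q) * h w)" for w
  proof -
    have "max (w * (r * p)) ((1 - w) * (r * q)) = r * max (w * p) ((1 - w) * q)"
      using assms by (simp add: max_mult_distrib_left[of r] mult.left_commute)
    then show ?thesis by simp
  qed
  then have "integral {0..1} (\<lambda>w. max (w * (r * p)) ((1 - w) * (r * q)) * h w)
    = integral {0..1} (\<lambda>w. r * (max (w * p) ((1 - w) * q) * h w))" by presburger
  then show ?thesis by (simp add: stdf_eq)
qed

lemma stdf_lipschitz: "\<bar>stdf p q - stdf p' q'\<bar> \<le> 2 * (\<bar>p - p'\<bar> + \<bar>q - q'\<bar>)"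
proof -
  have le: "stdf p q - stdf p' q' \<le> 2 * (\<bar>p - p'\<bar> + \<bar>q - q'\<bar>)" for p q p' q'
  proof -
    let ?C = "\<bar>p - p'\<bar> + \<bar>q - q'\<bar>"
    have h: "h integrable_on {0..1}" using integrable_mult_h[of "\<lambda>_. 1" 1 0 1] by simp
    have "integral {0..1} (\<lambda>w. max (w * p) ((1 - w) * q) * h w)
      \<le> integral {0..1} (\<lambda>w. max (w * p') ((1 - w) * q') * h w + ?C * h w)"
    proof (rule integral_le)
      show "(\<lambda>w. max (w * p') ((1 - w) * q') * h w + ?C * h w) integrable_on {0..1}"
        by (intro integrable_add integrable_max) (use integrable_mult_h[of "\<lambda>_. ?C" ?C 0 1] in auto)
      fix w :: real assume w: "w \<in> {0..1}"
      have "w * (p - p') \<le> ?C" "(1 - w) * (q - q') \<le> ?C"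
        using mult_left_mono[OF abs_ge_self[of "p - p'"], of w] mult_left_le_one_le[of "\<bar>p-p'\<bar>" w]
          mult_left_mono[OF abs_ge_self[of "q - q'"], of "1-w"] mult_left_le_one_le[of "\<bar>q-q'\<bar>" "1-w"] w
        by auto
      then have "max (w * p) ((1 - w) * q) \<le> max (w * p') ((1 - w) * q') + ?C"
        by (auto simp: max_def algebra_simps)
      from mult_right_mono[OF this, of "h w"]
      show "max (w * p) ((1 - w) * q) * h w \<le> max (w * p') ((1 - w) * q') * h w + ?C * h w"
        using w by (simp add: h_nonneg algebra_simps)
    qed (simp add: integrable_max)
    also have "\<dots> = integral {0..1} (\<lambda>w. max (w * p') ((1 - w) * q') * h w) + ?C * integral {0..1} h"
      by (subst integral_add) (use h integrable_mult_h[of "\<lambda>_. ?C" ?C 0 1] in \<open>auto simp: integrable_max\<close>)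
    finally show ?thesis by (simp add: stdf_eq integral_h)
  qed
  from le[of p q p' q'] le[of p' q' p q] show ?thesis by (simp add: abs_minus_commute abs_le_iff)
qed

lemma continuous_stdf: "continuous_on UNIV (\<lambda>(p, q). stdf p q)"
proof (rule continuous_on_eq_continuous_at[THEN iffD2], simp, clarify)
  fix p q :: real
  have "isCont (\<lambda>x. 2 * (\<bar>fst x - p\<bar> + \<bar>snd x - q\<bar>)) (p, q)"
    by (intro continuous_intros)
  then have lim: "((\<lambda>x. 2 * (\<bar>fst x - p\<bar> + \<bar>snd x - q\<bar>)) \<longlongrightarrow> 0) (at (p, q))"
    by (simp add: isCont_def)
  have "((\<lambda>x. stdf (fst x) (snd x) - stdf p q) \<longlongrightarrow> 0) (at (p, q))"
    by (rule tendsto_rabs_zero_cancel[OF tendsto_sandwich[OF _ _ tendsto_const lim]])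
      (intro always_eventually allI abs_ge_zero stdf_lipschitz)+
  then show "isCont (\<lambda>(p, q). stdf p q) (p, q)"
    by (simp add: isCont_def LIM_zero_iff case_prod_beta')
qed

end

section \<open>Extreme value copulas on the logarithmic scale\<close>

lemma ev_copula_exponent_measure:
  "ev_copula (exponent_measure H) u v
   = exp (- exponent_measure H (inverse (- ln u)) (inverse (- ln v)))"
  by (simp add: ev_copula_def divide_inverse)

locale spectral_smooth = spectral +
  assumes derivatives_exist: "exponent_derivatives_exist (exponent_measure H)"
begin

text \<open>By \<open>stdf_ge\<close> and \<open>stdf_eq_upper_lower\<close> the linear function with coefficients \<open>upper v\<close> and
  \<open>lower v\<close> supports \<open>stdf\<close> from below and touches it at the point under consideration. As
  \<open>stdf\<close> is differentiable, its derivative is that of the linear function; no differentiation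
  under the integral sign is required.\<close>
lemma stdf_deriv1:
  assumes "0 < p" "0 < q"
  shows "((\<lambda>p. stdf p q) has_real_derivative upper (q / (p + q))) (at p)"
proof -
  let ?v = "q / (p + q)"
  have v: "0 \<le> ?v" "?v \<le> 1" using assms by auto
  have "(\<lambda>a. exponent_measure H a (inverse q)) differentiable (at (inverse p))"
    using derivatives_exist assms by (simp add: exponent_derivatives_exist_def)
  then obtain D where "((\<lambda>a. exponent_measure H a (inverse q)) has_real_derivative D) (at (inverse p))"
    by (auto simp: real_differentiable_def)
  from DERIV_chain2[OF this DERIV_inverse] assms
  obtain E where E: "((\<lambda>p. stdf p q) has_real_derivative E) (at p)"
    unfolding stdf_def by auto
  have "((\<lambda>x. stdf x q - (upper ?v * x + lower ?v * q)) has_real_derivative E - upper ?v) (at p)"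
    by (auto intro!: derivative_eq_intros E)
  moreover have "stdf p q - (upper ?v * p + lower ?v * q) \<le> stdf x q - (upper ?v * x + lower ?v * q)" for x
    using stdf_ge[OF v, of x q] stdf_eq_upper_lower[OF assms] by simp
  ultimately have "E - upper ?v = 0"
    by (intro DERIV_local_min[where d = 1]) auto
  with E show ?thesis by simp
qed

lemma stdf_deriv2:
  assumes "0 < p" "0 < q"
  shows "((\<lambda>q. stdf p q) has_real_derivative lower (q / (p + q))) (at q)"
proof -
  let ?v = "q / (p + q)"
  have v: "0 \<le> ?v" "?v \<le> 1" using assms by auto
  have "(\<lambda>b. exponent_measure H (inverse p) b) differentiable (at (inverse q))"
    using derivatives_exist assms by (simp add: exponent_derivatives_exist_def)
  then obtain D where "((\<lambda>b. exponent_measure H (inverse p) b) has_real_derivative D) (at (inverse q))"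
    by (auto simp: real_differentiable_def)
  from DERIV_chain2[OF this DERIV_inverse] assms
  obtain E where E: "((\<lambda>q. stdf p q) has_real_derivative E) (at q)"
    unfolding stdf_def by auto
  have "((\<lambda>x. stdf p x - (upper ?v * p + lower ?v * x)) has_real_derivative E - lower ?v) (at q)"
    by (auto intro!: derivative_eq_intros E)
  moreover have "stdf p q - (upper ?v * p + lower ?v * q) \<le> stdf p x - (upper ?v * p + lower ?v * x)" for x
    using stdf_ge[OF v, of p x] stdf_eq_upper_lower[OF assms] by simp
  ultimately have "E - lower ?v = 0"
    by (intro DERIV_local_min[where d = 1]) auto
  with E show ?thesis by simp
qed

text \<open>The version of the spectral density that enters the copula density. It can differ from \<open>h\<close> on
  a null set.\<close>
definition dens :: "real \<Rightarrow> real" where "dens w = deriv lower w / (2 * (1 - w))"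

text \<open>The existence of the mixed derivative of \<open>V\<close> is used exactly here: it makes \<open>lower\<close>
  differentiable at every point of the open interval, not just almost everywhere.\<close>
lemma lower_deriv:
  assumes "0 < w" "w < 1"
  shows "(lower has_real_derivative 2 * (1 - w) * dens w) (at w)"
proof -
  have eq: "deriv (\<lambda>b. exponent_measure H a b) 1 = - lower (a / (1 + a))" if "0 < a" for a
  proof -
    have "((\<lambda>q. stdf (inverse a) q) has_real_derivative lower (inverse 1 / (inverse a + inverse 1))) (at (inverse 1))"
      using stdf_deriv2[of "inverse a" 1] that by simp
    from DERIV_chain2[OF this DERIV_inverse]
    have "((\<lambda>b. stdf (inverse a) (inverse b)) has_real_derivative - lower (inverse 1 / (inverse a + inverse 1))) (at 1)"
      by simp
    moreover have "inverse 1 / (inverse a + inverse 1) = a / (1 + a)"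
      using that by (simp add: field_simps)
    ultimately show ?thesis by (simp add: stdf_def DERIV_imp_deriv)
  qed
  have "(\<lambda>a. deriv (\<lambda>b. exponent_measure H a b) 1) differentiable (at (w / (1 - w)))"
    using derivatives_exist assms by (simp add: exponent_derivatives_exist_def)
  then obtain D where D: "((\<lambda>a. deriv (\<lambda>b. exponent_measure H a b) 1) has_real_derivative D) (at (w / (1 - w)))"
    by (auto simp: real_differentiable_def)
  have "((\<lambda>w. w / (1 - w)) has_real_derivative 1 / (1 - w)\<^sup>2) (at w)"
    using assms by (auto intro!: derivative_eq_intros simp: power2_eq_square)
  from DERIV_minus[OF DERIV_chain2[OF D this]]
  obtain E where E: "((\<lambda>w. - deriv (\<lambda>b. exponent_measure H (w / (1 - w)) b) 1) has_real_derivative E) (at w)"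
    by blast
  have "(lower has_real_derivative E) (at w)"
  proof (rule has_field_derivative_transform_within_open[OF E, of "{0<..<1}"])
    fix x :: real assume x: "x \<in> {0<..<1}"
    then have "x / (1 - x) / (1 + x / (1 - x)) = x" by (simp add: divide_simps)
    with x show "- deriv (\<lambda>b. exponent_measure H (x / (1 - x)) b) 1 = lower x"
      by (subst eq) auto
  qed (use assms in auto)
  moreover from this have "E = 2 * (1 - w) * dens w"
    using assms by (simp add: dens_def DERIV_imp_deriv)
  ultimately show ?thesis by simp
qed

text \<open>Increments of \<open>lower\<close> are integrals of \<open>2 * (1 - u) * h u\<close>, so a bound for \<open>h\<close> near \<open>w\<close> bounds
  the derivative of \<open>lower\<close> at \<open>w\<close>. The sign \<open>s\<close> covers lower and upper bounds at once.\<close>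
lemma dens_bound_signed:
  assumes w: "0 < w" "w < 1" and ev: "\<forall>\<^sub>F u in nhds w. s * m \<le> s * h u"
  shows "s * m \<le> s * dens w"
proof (rule ccontr)
  \<comment> \<open>\<open>2 * x - x\<^sup>2\<close> is an antiderivative of \<open>2 * (1 - x)\<close>, so \<open>G\<close> should be increasing near \<open>w\<close>\<close>
  define G where "G x = s * (lower x - m * (2 * x - x\<^sup>2))" for x
  assume "\<not> s * m \<le> s * dens w"
  then have neg: "2 * (1 - w) * (s * dens w - s * m) < 0" using w by (simp add: mult_pos_neg)
  have "(G has_real_derivative 2 * (1 - w) * (s * dens w - s * m)) (at w)"
    unfolding G_def using w by (auto intro!: derivative_eq_intros lower_deriv simp: algebra_simps)
  from DERIV_neg_dec_right[OF this neg]
  obtain d where d: "0 < d" "\<And>e. 0 < e \<Longrightarrow> e < d \<Longrightarrow> G (w + e) < G w" by auto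
  from ev obtain r where r: "0 < r" "\<And>u. dist u w < r \<Longrightarrow> s * m \<le> s * h u"
    by (auto simp: eventually_nhds_metric)
  define e where "e = min d (min r (1 - w)) / 2"
  have e: "0 < e" "e < d" "e < r" "w + e < 1" using d(1) r(1) w by (auto simp: e_def min_def field_simps)
  have 1: "((\<lambda>u. (1 - u) * m) has_integral (m * ((w+e) - (w+e)\<^sup>2/2) - m * (w - w\<^sup>2/2))) {w..w+e}"
    using e by (intro fundamental_theorem_of_calculus)
      (auto intro!: derivative_eq_intros simp flip: has_real_derivative_iff_has_vector_derivative simp: algebra_simps)
  have "integral {w..w+e} (\<lambda>u. s * ((1 - u) * m)) \<le> integral {w..w+e} (\<lambda>u. s * ((1 - u) * h u))"
  proof (intro integral_le integrable_on_mult_right)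
    show "(\<lambda>u. (1 - u) * m) integrable_on {w..w+e}" using 1 by (auto simp: integrable_on_def)
    show "(\<lambda>u. (1 - u) * h u) integrable_on {w..w+e}" using e w by (intro integrable_ch) auto
    fix u assume u: "u \<in> {w..w+e}"
    then have "s * m \<le> s * h u" using e by (intro r) (auto simp: dist_real_def)
    from mult_left_mono[OF this, of "1 - u"] u e
    show "s * ((1 - u) * m) \<le> s * ((1 - u) * h u)" by (simp add: ac_simps)
  qed
  then have "s * (m * ((w+e) - (w+e)\<^sup>2/2) - m * (w - w\<^sup>2/2)) \<le> s * ((lower (w + e) - lower w) / 2)"
    using integral_unique[OF 1] lower_diff[of w "w + e"] e w by simp
  then have "G w \<le> G (w + e)" by (simp add: G_def field_simps)
  with d(2)[OF e(1,2)] show False by simp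
qed

lemma dens_ge:
  assumes "0 < w" "w < 1" "\<forall>\<^sub>F u in nhds w. m \<le> h u"
  shows "m \<le> dens w"
  using dens_bound_signed[OF assms(1,2), of 1 m] assms(3) by simp

lemma dens_le:
  assumes "0 < w" "w < 1" "\<forall>\<^sub>F u in nhds w. h u \<le> m"
  shows "dens w \<le> m"
  using dens_bound_signed[OF assms(1,2), of "-1" m] assms(3) by simp

definition kernel :: "real \<Rightarrow> real \<Rightarrow> real" where
  "kernel p q = upper (q / (p + q)) * lower (q / (p + q)) + 2 * dens (q / (p + q)) * (p * q / (p + q) ^ 3)"

abbreviation C :: "real \<Rightarrow> real \<Rightarrow> real" where "C \<equiv> ev_copula (exponent_measure H)"

lemma ev_copula_stdf: "C u v = exp (- stdf (- ln u) (- ln v))"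
  by (simp add: ev_copula_exponent_measure stdf_def)

lemma ev_copula_deriv1:
  assumes "0 < u" "u < 1" "0 < v" "v < 1"
  defines "p \<equiv> - ln u" and "q \<equiv> - ln v"
  shows "((\<lambda>a. C a v) has_real_derivative exp (p - stdf p q) * upper (q / (p + q))) (at u)"
proof -
  have pq: "0 < p" "0 < q" using assms by auto
  have "((\<lambda>a. - ln a) has_real_derivative - (1 / u)) (at u)"
    using assms(1) by (auto intro!: derivative_eq_intros)
  from DERIV_chain2[OF _ this, of "\<lambda>p. stdf p q"] stdf_deriv1[OF pq]
  have "((\<lambda>a. stdf (- ln a) q) has_real_derivative upper (q / (p + q)) * - (1 / u)) (at u)"
    unfolding p_def by blast
  from DERIV_chain2[OF DERIV_exp DERIV_minus[OF this]]
  have "((\<lambda>a. C a v) has_real_derivative exp (- stdf p q) * - (upper (q / (p + q)) * - (1 / u))) (at u)"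
    by (simp add: ev_copula_stdf p_def q_def)
  moreover have "exp (- stdf p q) * - (upper (q / (p + q)) * - (1 / u)) = exp (p - stdf p q) * upper (q / (p + q))"
    using assms(1) by (simp add: p_def exp_diff exp_minus divide_inverse)
  ultimately show ?thesis by simp
qed

lemma ev_copula_deriv2:
  assumes "0 < u" "u < 1" "0 < v" "v < 1"
  defines "p \<equiv> - ln u" and "q \<equiv> - ln v"
  shows "((\<lambda>b. C u b) has_real_derivative exp (q - stdf p q) * lower (q / (p + q))) (at v)"
proof -
  have pq: "0 < p" "0 < q" using assms by auto
  have "((\<lambda>a. - ln a) has_real_derivative - (1 / v)) (at v)"
    using assms(3) by (auto intro!: derivative_eq_intros)
  from DERIV_chain2[OF _ this, of "\<lambda>q. stdf p q"] stdf_deriv2[OF pq]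
  have "((\<lambda>b. stdf p (- ln b)) has_real_derivative lower (q / (p + q)) * - (1 / v)) (at v)"
    unfolding q_def by blast
  from DERIV_chain2[OF DERIV_exp DERIV_minus[OF this]]
  have "((\<lambda>b. C u b) has_real_derivative exp (- stdf p q) * - (lower (q / (p + q)) * - (1 / v))) (at v)"
    by (simp add: ev_copula_stdf p_def q_def)
  moreover have "exp (- stdf p q) * - (lower (q / (p + q)) * - (1 / v)) = exp (q - stdf p q) * lower (q / (p + q))"
    using assms(3) by (simp add: q_def exp_diff exp_minus divide_inverse)
  ultimately show ?thesis by simp
qed

lemma partial2_ev_copula:
  assumes "0 < u" "u < 1" "0 < v" "v < 1"
  shows "partial2 C u v = exp (- ln v - stdf (- ln u) (- ln v)) * lower (- ln v / (- ln u + - ln v))"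
  unfolding partial2_def by (intro DERIV_imp_deriv ev_copula_deriv2 assms)

lemma partial1_ev_copula:
  assumes "0 < u" "u < 1" "0 < v" "v < 1"
  shows "partial1 C u v = exp (- ln u - stdf (- ln u) (- ln v)) * upper (- ln v / (- ln u + - ln v))"
  unfolding partial1_def by (intro DERIV_imp_deriv ev_copula_deriv1 assms)

text \<open>Differentiating \<open>exp (q - stdf p q) * lower (q / (p + q))\<close> in \<open>p\<close> produces one term from the
  exponential and one from \<open>lower\<close>; together they form the kernel.\<close>
lemma partial2_ev_copula_deriv1:
  assumes "0 < u" "u < 1" "0 < v" "v < 1"
  defines "p \<equiv> - ln u" and "q \<equiv> - ln v"
  shows "((\<lambda>a. partial2 C a v) has_real_derivative exp (p + q - stdf p q) * kernel p q) (at u)"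
proof -
  have pq: "0 < p" "0 < q" using assms by auto
  let ?w = "q / (p + q)"
  have w: "0 < ?w" "?w < 1" "1 - ?w = p / (p + q)" using pq by (auto simp: field_simps)
  have "((\<lambda>p. q / (p + q)) has_real_derivative - (q / (p + q)\<^sup>2)) (at p)"
    using pq by (auto intro!: derivative_eq_intros simp: power2_eq_square)
  from DERIV_chain2[OF lower_deriv[OF w(1,2)] this]
  have L: "((\<lambda>p. lower (q / (p + q))) has_real_derivative 2 * (p / (p + q)) * dens ?w * - (q / (p + q)\<^sup>2)) (at p)"
    by (simp only: w)
  have "((\<lambda>p. exp (q - stdf p q) * lower (q / (p + q))) has_real_derivative
      - (exp (q - stdf p q) * kernel p q)) (at p)"
    by (rule derivative_eq_intros L stdf_deriv1 pq refl)+
      (use pq in \<open>simp add: kernel_def field_simps power2_eq_square power3_eq_cube\<close>)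
  moreover have "((\<lambda>a. - ln a) has_real_derivative - (1 / u)) (at u)"
    using assms(1) by (auto intro!: derivative_eq_intros)
  ultimately have "((\<lambda>a. exp (q - stdf (- ln a) q) * lower (q / (- ln a + q))) has_real_derivative
      - (exp (q - stdf p q) * kernel p q) * - (1 / u)) (at u)"
    unfolding p_def by (rule DERIV_chain2)
  moreover have "- (exp (q - stdf p q) * kernel p q) * - (1 / u) = exp (p + q - stdf p q) * kernel p q"
    using assms(1) by (simp add: p_def exp_add exp_diff exp_minus divide_inverse)
  ultimately have "((\<lambda>a. exp (q - stdf (- ln a) q) * lower (q / (- ln a + q))) has_real_derivative
      exp (p + q - stdf p q) * kernel p q) (at u)" by simp
  then show ?thesis
    by (rule has_field_derivative_transform_within_open[of _ _ _ "{0<..<1}"])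
      (use assms in \<open>auto simp: partial2_ev_copula\<close>)
qed

lemma ev_copula_density:
  assumes "0 < u" "u < 1" "0 < v" "v < 1"
  shows "copula_density C u v
    = exp (- ln u + - ln v - stdf (- ln u) (- ln v)) * kernel (- ln u) (- ln v)"
  unfolding copula_density_def partial1_def
  by (intro DERIV_imp_deriv partial2_ev_copula_deriv1 assms)

abbreviation C_inv :: "real \<Rightarrow> real \<Rightarrow> real" where "C_inv \<equiv> inverted_ev_copula (exponent_measure H)"

text \<open>The inverted copula is the survival copula of the extreme value copula, so its derivatives are
  those of \<open>C\<close> at the complementary probabilities.\<close>
lemma inverted_ev_copula_eq: "C_inv u v = u + v - 1 + C (1 - u) (1 - v)"
  by (simp add: inverted_ev_copula_def ev_copula_def)

lemma partial1_inverted_ev_copula: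
  assumes "0 < u" "u < 1" "0 < v" "v < 1"
  shows "partial1 C_inv u v = 1 - partial1 C (1 - u) (1 - v)"
proof -
  have "((\<lambda>a. C a (1 - v)) has_real_derivative partial1 C (1 - u) (1 - v)) (at (1 - u))"
    using ev_copula_deriv1[of "1 - u" "1 - v"] assms by (simp add: partial1_ev_copula)
  then have "((\<lambda>a. C (1 - a) (1 - v)) has_real_derivative partial1 C (1 - u) (1 - v) * -1) (at u)"
    by (rule DERIV_chain2) (auto intro!: derivative_eq_intros)
  then have "((\<lambda>a. C_inv a v) has_real_derivative 1 - partial1 C (1 - u) (1 - v)) (at u)"
    unfolding inverted_ev_copula_eq by (auto intro!: derivative_eq_intros)
  then show ?thesis unfolding partial1_def[of C_inv] by (rule DERIV_imp_deriv)
qed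

lemma partial2_inverted_ev_copula:
  assumes "0 < u" "u < 1" "0 < v" "v < 1"
  shows "partial2 C_inv u v = 1 - partial2 C (1 - u) (1 - v)"
proof -
  have "((\<lambda>b. C (1 - u) b) has_real_derivative partial2 C (1 - u) (1 - v)) (at (1 - v))"
    using ev_copula_deriv2[of "1 - u" "1 - v"] assms by (simp add: partial2_ev_copula)
  then have "((\<lambda>b. C (1 - u) (1 - b)) has_real_derivative partial2 C (1 - u) (1 - v) * -1) (at v)"
    by (rule DERIV_chain2) (auto intro!: derivative_eq_intros)
  then have "((\<lambda>b. C_inv u b) has_real_derivative 1 - partial2 C (1 - u) (1 - v)) (at v)"
    unfolding inverted_ev_copula_eq by (auto intro!: derivative_eq_intros)
  then show ?thesis unfolding partial2_def[of C_inv] by (rule DERIV_imp_deriv)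
qed

lemma inverted_ev_copula_density:
  assumes "0 < u" "u < 1" "0 < v" "v < 1"
  shows "copula_density C_inv u v = copula_density C (1 - u) (1 - v)"
proof -
  have "((\<lambda>a. partial2 C a (1 - v)) has_real_derivative copula_density C (1 - u) (1 - v)) (at (1 - u))"
    using partial2_ev_copula_deriv1[of "1 - u" "1 - v"] assms by (simp add: ev_copula_density)
  then have "((\<lambda>a. partial2 C (1 - a) (1 - v)) has_real_derivative copula_density C (1 - u) (1 - v) * -1) (at u)"
    by (rule DERIV_chain2) (auto intro!: derivative_eq_intros)
  then have "((\<lambda>a. 1 - partial2 C (1 - a) (1 - v)) has_real_derivative copula_density C (1 - u) (1 - v)) (at u)"
    by (auto intro!: derivative_eq_intros)
  then have "((\<lambda>a. partial2 C_inv a v) has_real_derivative copula_density C (1 - u) (1 - v)) (at u)"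
    by (rule has_field_derivative_transform_within_open[of _ _ _ "{0<..<1}"])
      (use assms in \<open>auto simp: partial2_inverted_ev_copula\<close>)
  then show ?thesis
    unfolding copula_density_def[of C_inv] partial1_def[of "partial2 C_inv"] by (rule DERIV_imp_deriv)
qed

end

section \<open>Behaviour at the end points of the spectral interval\<close>

lemma asymp_equiv_imp_comparable:
  assumes fg: "asymp_equiv f F (\<lambda>x. c * g x)" and "c \<noteq> 0" "F \<noteq> bot"
    and g: "\<forall>\<^sub>F x in F. 0 < g x" and f: "\<forall>\<^sub>F x in F. 0 \<le> f x"
  shows "comparable F f (g :: 'a \<Rightarrow> real)"
proof -
  have "((\<lambda>x. f x / (c * g x)) \<longlongrightarrow> 1) F"
    using g \<open>c \<noteq> 0\<close> by (intro asymp_equivD_strong[OF fg]) (auto elim: eventually_mono)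
  from tendsto_mult[OF tendsto_const[of c] this]
  have "((\<lambda>x. c * (f x / (c * g x))) \<longlongrightarrow> c) F" by simp
  then have lim: "((\<lambda>x. f x / g x) \<longlongrightarrow> c) F" using \<open>c \<noteq> 0\<close> by simp
  moreover have "\<forall>\<^sub>F x in F. 0 \<le> f x / g x" using f g by eventually_elim simp
  ultimately have "0 \<le> c" using \<open>F \<noteq> bot\<close> by (intro tendsto_lowerbound)
  with \<open>c \<noteq> 0\<close> have "0 < c" by simp
  have "\<forall>\<^sub>F x in F. c/2 < f x / g x" "\<forall>\<^sub>F x in F. f x / g x < 2 * c"
    using order_tendstoD(1)[OF lim, of "c/2"] order_tendstoD(2)[OF lim, of "2*c"] \<open>0 < c\<close> by linarith+
  with g have "\<forall>\<^sub>F x in F. c/2 * g x \<le> f x" "\<forall>\<^sub>F x in F. f x \<le> 2 * c * g x"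
    by (eventually_elim; simp add: field_simps)+
  with g \<open>0 < c\<close> show ?thesis by (intro comparableI[of "c/2" _ _ _ "2*c"]) auto
qed

text \<open>The integrand is compared with the power on the whole interval except at 0, where
  \<open>0 powr s = 0\<close> says nothing about \<open>f\<close>; changing \<open>f\<close> at this point leaves the integral alone.\<close>
lemma comparable_integral_powr:
  assumes s: "-1 < s" and f: "comparable (at_right 0) f (\<lambda>w. w powr s)"
    and int: "\<And>w. 0 \<le> w \<Longrightarrow> w \<le> 1 \<Longrightarrow> f integrable_on {0..w}"
  shows "comparable (at_right 0) (\<lambda>w. integral {0..w} f) (\<lambda>w. w powr (1 + s))"
proof -
  obtain k K where k: "0 < k" "0 < K" "\<forall>\<^sub>F w in at_right 0. k * w powr s \<le> f w"
    "\<forall>\<^sub>F w in at_right 0. f w \<le> K * w powr s"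
    by (rule comparableE[OF f])
  from eventually_conj[OF k(3,4)] obtain d where d: "0 < d"
    "\<And>w. 0 < w \<Longrightarrow> w < d \<Longrightarrow> k * w powr s \<le> f w \<and> f w \<le> K * w powr s"
    by (auto simp: eventually_at_right_field)
  define f0 where "f0 w = (if w = 0 then 0 else f w)" for w
  have f0: "(f0 has_integral integral {0..w} f) {0..w}" if "0 \<le> w" "w \<le> 1" for w
    by (rule has_integral_spike_finite[of "{0}" _ _ f])
      (use int[OF that] in \<open>auto simp: f0_def has_integral_integral\<close>)
  have P: "((\<lambda>x. c * x powr s) has_integral c * (w powr (1 + s) / (1 + s))) {0..w}" if "0 \<le> w" for w c
    using has_integral_mult_right[OF has_integral_powr_from_0[OF s that]] by (simp add: add.commute)
  have ev: "\<forall>\<^sub>F w in at_right (0::real). 0 < w \<and> w < min d 1"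
    using d(1) by (auto simp: eventually_at_right_field intro!: exI[of _ "min d 1"])
  show ?thesis
  proof (rule comparableI[of "k / (1 + s)" _ _ _ "K / (1 + s)"])
    show "\<forall>\<^sub>F w in at_right 0. k / (1 + s) * w powr (1 + s) \<le> integral {0..w} f" using ev
    proof eventually_elim
      case (elim w)
      then have "k * (w powr (1 + s) / (1 + s)) \<le> integral {0..w} f"
        by (intro has_integral_le[OF P f0]) (use d(2) in \<open>auto simp: f0_def\<close>)
      then show ?case by simp
    qed
    show "\<forall>\<^sub>F w in at_right 0. integral {0..w} f \<le> K / (1 + s) * w powr (1 + s)" using ev
    proof eventually_elim
      case (elim w)
      then have "integral {0..w} f \<le> K * (w powr (1 + s) / (1 + s))"
        by (intro has_integral_le[OF f0 P]) (use d(2) in \<open>auto simp: f0_def\<close>)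
      then show ?case by simp
    qed
    show "\<forall>\<^sub>F w::real in at_right 0. 0 < w powr (1 + s)" using ev by eventually_elim simp
  qed (use k s in auto)
qed

lemma has_integral_mirror:
  fixes f :: "real \<Rightarrow> real"
  assumes "f integrable_on {1 - w..1}"
  shows "((\<lambda>u. f (1 - u)) has_integral integral {1 - w..1} f) {0..w}"
proof -
  have "(f has_integral integral {1 - w..1} f) (cbox (1 - w) 1)"
    using assms by (simp add: has_integral_integral)
  from has_integral_affinity[OF this, of "-1" 1]
  have "((\<lambda>u. f (1 - u)) has_integral integral {1 - w..1} f) ((\<lambda>x. 1 - x) ` {1 - w..1})"
    by simp
  then show ?thesis by simp
qed

lemma comparable_const: "0 < (c::real) \<Longrightarrow> comparable F (\<lambda>_. c) (\<lambda>_. 1)"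
  by (rule tendsto_imp_comparable_1[OF tendsto_const])

text \<open>The two terms of the kernel have the rates \<open>(1 + s) * (b - a)\<close> and \<open>(1 + s) * (b - a) - a\<close>; as
  \<open>a \<ge> 0\<close>, the second, which comes from the mixed derivative, dominates. Since \<open>P\<close>, \<open>Q\<close> and \<open>D\<close>
  are arbitrary functions, the lemma serves both end points, the roles of \<open>upper\<close> and \<open>lower\<close> being
  exchanged by the reflection \<open>w \<mapsto> 1 - w\<close>.\<close>
lemma kernel_decay_aux:
  assumes P: "comparable (at_right 0) P (\<lambda>_. 1)"
    and Q: "comparable (at_right 0) Q (\<lambda>w. w powr (1 + s))"
    and D: "comparable (at_right 0) D (\<lambda>w. w powr s)"
    and p: "exp_decay p a" and q: "exp_decay q b" and ab: "0 \<le> a" "a < b"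
  defines "w \<equiv> \<lambda>t. q t / (p t + q t)"
  shows "exp_decay (\<lambda>t. P (w t) * Q (w t) + 2 * D (w t) * (p t * q t / (p t + q t) ^ 3)) ((1 + s) * (b - a) - a)"
proof -
  have "exp_decay w (b - min a b)"
    unfolding w_def by (intro exp_decay_divide exp_decay_add p q)
  then have w: "exp_decay w (b - a)" using ab by simp
  have "exp_decay (\<lambda>t. P (w t)) 0"
    by (intro exp_decay_comparable_1 comparable_compose[OF P] exp_decay_filterlim[OF w]) (use ab in simp)
  moreover have "exp_decay (\<lambda>t. Q (w t)) ((1 + s) * (b - a))"
    by (rule exp_decay_compose[OF Q w]) (use ab in simp)
  moreover have "exp_decay (\<lambda>t. D (w t)) (s * (b - a))"
    by (rule exp_decay_compose[OF D w]) (use ab in simp)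
  moreover have "exp_decay (\<lambda>_. 2) 0" by (rule exp_decay_tendsto[OF tendsto_const]) simp
  ultimately have "exp_decay (\<lambda>t. P (w t) * Q (w t) + 2 * D (w t) * (p t * q t / (p t + q t) ^ 3))
    (min (0 + (1 + s) * (b - a)) (0 + s * (b - a) + (a + b - real 3 * min a b)))"
    by (intro exp_decay_add exp_decay_mult exp_decay_divide exp_decay_power p q)
  moreover have "min (0 + (1 + s) * (b - a)) (0 + s * (b - a) + (a + b - real 3 * min a b)) = (1 + s) * (b - a) - a"
    using ab by (simp add: min_def algebra_simps)
  ultimately show ?thesis by simp
qed

locale spectral_tail = spectral_smooth +
  fixes s1 s2 :: real
  assumes tails: "tail_conditions h s1 s2"
begin

lemma s1: "-1 < s1" and s2: "-1 < s2"
  using tails by (auto simp: tail_conditions_def)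

lemma filterlim_mirror: "filterlim (\<lambda>w::real. 1 - w) (at_left 1) (at_right 0)"
proof -
  have "((\<lambda>w::real. 1 - w) \<longlongrightarrow> 1) (at_right 0)" by (auto intro!: tendsto_eq_intros)
  then show ?thesis
    by (auto simp: filterlim_at intro: eventually_mono[OF eventually_at_right_less])
qed

lemma h_tail_0: "comparable (at_right 0) h (\<lambda>w. w powr s2)"
proof -
  obtain c where "c \<noteq> 0" "asymp_equiv h (at_right 0) (\<lambda>w. c * w powr s2)"
    using tails by (auto simp: tail_conditions_def)
  moreover have "\<forall>\<^sub>F w::real in at_right 0. w \<in> {0<..<1}"
    by (rule eventually_at_right_real) simp
  then have "\<forall>\<^sub>F w::real in at_right 0. 0 < w powr s2" "\<forall>\<^sub>F w::real in at_right 0. 0 \<le> h w"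
    by (eventually_elim; simp add: h_nonneg)+
  ultimately show ?thesis by (intro asymp_equiv_imp_comparable) auto
qed

lemma h_tail_1: "comparable (at_right 0) (\<lambda>w. h (1 - w)) (\<lambda>w. w powr s1)"
proof -
  obtain c where "c \<noteq> 0" "asymp_equiv h (at_left 1) (\<lambda>w. c * (1 - w) powr s1)"
    using tails by (auto simp: tail_conditions_def)
  moreover have "\<forall>\<^sub>F w::real in at_left 1. w \<in> {0<..<1}"
    by (rule eventually_at_left_real) simp
  then have "\<forall>\<^sub>F w::real in at_left 1. 0 < (1 - w) powr s1" "\<forall>\<^sub>F w::real in at_left 1. 0 \<le> h w"
    by (eventually_elim; simp add: h_nonneg)+
  ultimately have "comparable (at_left 1) h (\<lambda>w. (1 - w) powr s1)"
    by (intro asymp_equiv_imp_comparable) auto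
  from comparable_compose[OF this filterlim_mirror] show ?thesis by simp
qed

lemma comparable_1_minus: "comparable (at_right 0) (\<lambda>w::real. 1 - w) (\<lambda>_. 1)"
  by (rule tendsto_imp_comparable_1[of _ 1]) (auto intro!: tendsto_eq_intros)

lemma lower_tail_0: "comparable (at_right 0) lower (\<lambda>w. w powr (1 + s2))"
proof -
  have "comparable (at_right 0) (\<lambda>u. (1 - u) * h u) (\<lambda>w. w powr s2)"
    using comparable_mult[OF comparable_1_minus h_tail_0] by simp
  from comparable_mult[OF comparable_const[of 2] comparable_integral_powr[OF s2 this integrable_ch]]
  show ?thesis by (simp add: lower_def[abs_def])
qed

lemma upper_tail_1: "comparable (at_right 0) (\<lambda>w. upper (1 - w)) (\<lambda>w. w powr (1 + s1))"
proof -
  have 1: "comparable (at_right 0) (\<lambda>u. (1 - u) * h (1 - u)) (\<lambda>w. w powr s1)"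
    using comparable_mult[OF comparable_1_minus h_tail_1] by simp
  have 2: "((\<lambda>u. (1 - u) * h (1 - u)) has_integral integral {1 - w..1} (\<lambda>u. u * h u)) {0..w}"
    if "0 \<le> w" "w \<le> 1" for w
    using that by (intro has_integral_mirror[of "\<lambda>u. u * h u"] integrable_uh) auto
  have "comparable (at_right 0) (\<lambda>w. 2 * integral {0..w} (\<lambda>u. (1 - u) * h (1 - u))) (\<lambda>w. 1 * w powr (1 + s1))"
    by (intro comparable_mult comparable_const comparable_integral_powr s1 1 has_integral_integrable[OF 2]) auto
  moreover have "\<forall>\<^sub>F w in at_right (0::real). w \<in> {0<..<1}"
    by (rule eventually_at_right_real) simp
  then have "\<forall>\<^sub>F w in at_right 0. 2 * integral {0..w} (\<lambda>u. (1 - u) * h (1 - u)) = upper (1 - w)"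
    by eventually_elim (simp add: upper_def integral_unique[OF 2])
  ultimately show ?thesis by (rule comparable_eventually_eq) simp
qed

text \<open>The exponent is one larger than that of \<open>upper_tail_1\<close>, since \<open>1 - u\<close> instead of \<open>u\<close> multiplies the
  density near 1. It is the source of the constant \<open>2 + s1\<close> in the rate of the conditional
  distribution function.\<close>
lemma lower_tail_1: "comparable (at_right 0) (\<lambda>w. 1 - lower (1 - w)) (\<lambda>w. w powr (2 + s1))"
proof -
  have "comparable (at_right 0) (\<lambda>u. u powr 1 * h (1 - u)) (\<lambda>w. w powr 1 * w powr s1)"
    by (intro comparable_mult h_tail_1 comparableI[of 1 _ _ _ 1])
      (auto intro: eventually_mono[OF eventually_at_right_less])
  moreover have "\<forall>\<^sub>F w in at_right (0::real). w \<in> {0<..<1}"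
    by (rule eventually_at_right_real) simp
  then have "\<forall>\<^sub>F u in at_right 0. u powr 1 * h (1 - u) = u * h (1 - u)"
    by eventually_elim simp
  ultimately have 1: "comparable (at_right 0) (\<lambda>u. u * h (1 - u)) (\<lambda>w. w powr (1 + s1))"
    by (rule comparable_eventually_eq) (simp add: powr_add)
  have 2: "((\<lambda>u. u * h (1 - u)) has_integral integral {1 - w..1} (\<lambda>u. (1 - u) * h u)) {0..w}"
    if "0 \<le> w" "w \<le> 1" for w
    using has_integral_mirror[of "\<lambda>u. (1 - u) * h u" w] that by (simp add: integrable_ch)
  have "comparable (at_right 0) (\<lambda>w. 2 * integral {0..w} (\<lambda>u. u * h (1 - u))) (\<lambda>w. 1 * w powr (1 + (1 + s1)))"
    by (intro comparable_mult comparable_const comparable_integral_powr 1 has_integral_integrable[OF 2]) (use s1 in auto)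
  moreover have "\<forall>\<^sub>F w in at_right (0::real). w \<in> {0<..<1}"
    by (rule eventually_at_right_real) simp
  then have "\<forall>\<^sub>F w in at_right 0. 2 * integral {0..w} (\<lambda>u. u * h (1 - u)) = 1 - lower (1 - w)"
  proof eventually_elim
    case (elim w)
    then show ?case using lower_diff[of "1 - w" 1] by (simp add: lower_1 integral_unique[OF 2])
  qed
  ultimately show ?thesis by (rule comparable_eventually_eq) simp
qed

lemma lower_pos:
  assumes "0 < w" "w \<le> 1"
  shows "0 < lower w"
proof -
  have "\<forall>\<^sub>F v in at_right 0. 0 < lower v" by (rule comparable_pos[OF lower_tail_0])
  moreover have "\<forall>\<^sub>F v in at_right 0. v \<in> {0<..<w}" by (rule eventually_at_right_real) fact
  ultimately have "\<forall>\<^sub>F v in at_right 0. 0 < lower v \<and> v \<in> {0<..<w}" by (rule eventually_conj)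
  then obtain v where "0 < lower v" "0 < v" "v < w"
    using eventually_happens'[OF trivial_limit_at_right_real] by fastforce
  with lower_mono[of v w] assms show ?thesis by simp
qed

lemma upper_pos:
  assumes "0 \<le> w" "w < 1"
  shows "0 < upper w"
proof -
  have "\<forall>\<^sub>F v in at_right 0. 0 < upper (1 - v)" by (rule comparable_pos[OF upper_tail_1])
  moreover have "\<forall>\<^sub>F v in at_right 0. v \<in> {0<..<1 - w}" by (rule eventually_at_right_real) (use assms in simp)
  ultimately have "\<forall>\<^sub>F v in at_right 0. 0 < upper (1 - v) \<and> v \<in> {0<..<1-w}" by (rule eventually_conj)
  then obtain v where "0 < upper (1 - v)" "0 < v" "v < 1 - w"
    using eventually_happens'[OF trivial_limit_at_right_real] by fastforce
  with upper_antimono[of w "1 - v"] assms show ?thesis by simp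
qed

lemma lower_less_1:
  assumes "0 \<le> w" "w < 1"
  shows "lower w < 1"
proof -
  have "\<forall>\<^sub>F v in at_right 0. 0 < 1 - lower (1 - v)" by (rule comparable_pos[OF lower_tail_1])
  moreover have "\<forall>\<^sub>F v in at_right 0. v \<in> {0<..<1 - w}" by (rule eventually_at_right_real) (use assms in simp)
  ultimately have "\<forall>\<^sub>F v in at_right 0. 0 < 1 - lower (1 - v) \<and> v \<in> {0<..<1-w}" by (rule eventually_conj)
  then obtain v where "0 < 1 - lower (1 - v)" "0 < v" "v < 1 - w"
    using eventually_happens'[OF trivial_limit_at_right_real] by fastforce
  with lower_mono[of w "1 - v"] assms show ?thesis by simp
qed

lemma upper_near_0: "comparable (at_right 0) upper (\<lambda>_. 1)"
proof (rule comparableI[of "upper (1/2)" _ _ _ 1])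
  have ev: "\<forall>\<^sub>F w in at_right (0::real). w \<in> {0<..<1/2}" by (rule eventually_at_right_real) simp
  from ev show "\<forall>\<^sub>F w in at_right 0. upper (1/2) * 1 \<le> upper w"
    by eventually_elim (simp add: upper_antimono)
  from ev show "\<forall>\<^sub>F w in at_right 0. upper w \<le> 1 * 1"
    by eventually_elim (simp add: upper_le_1)
qed (auto simp: upper_pos)

lemma lower_near_1: "comparable (at_right 0) (\<lambda>w. lower (1 - w)) (\<lambda>_. 1)"
proof (rule comparableI[of "lower (1/2)" _ _ _ 1])
  have ev: "\<forall>\<^sub>F w in at_right (0::real). w \<in> {0<..<1/2}" by (rule eventually_at_right_real) simp
  from ev show "\<forall>\<^sub>F w in at_right 0. lower (1/2) * 1 \<le> lower (1 - w)"
    by eventually_elim (simp add: lower_mono)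
  from ev show "\<forall>\<^sub>F w in at_right 0. lower (1 - w) \<le> 1 * 1"
    by eventually_elim (simp add: lower_le_1)
qed (auto simp: lower_pos)

lemma dens_between:
  assumes w: "0 < w" "w < 1" and cont: "isCont \<rho> w" and pos: "0 < \<rho> w"
    and kK: "0 < k" "0 < K"
    and ev: "\<forall>\<^sub>F u in nhds w. k * \<rho> u \<le> h u \<and> h u \<le> K * \<rho> u"
  shows "k / 2 * \<rho> w \<le> dens w" "dens w \<le> 2 * K * \<rho> w"
proof -
  have lim: "(\<rho> \<longlongrightarrow> \<rho> w) (nhds w)" using cont by (simp add: isCont_def tendsto_at_iff_tendsto_nhds)
  have "\<forall>\<^sub>F u in nhds w. \<rho> w / 2 < \<rho> u" "\<forall>\<^sub>F u in nhds w. \<rho> u < 2 * \<rho> w"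
    using order_tendstoD(1)[OF lim, of "\<rho> w / 2"] order_tendstoD(2)[OF lim, of "2 * \<rho> w"] pos by linarith+
  with ev have both: "\<forall>\<^sub>F u in nhds w. k / 2 * \<rho> w \<le> h u \<and> h u \<le> 2 * K * \<rho> w"
  proof eventually_elim
    case (elim u)
    have "k * (\<rho> w / 2) \<le> k * \<rho> u" "K * \<rho> u \<le> K * (2 * \<rho> w)"
      using elim kK by (intro mult_left_mono; simp)+
    with elim show ?case by (simp add: ac_simps)
  qed
  show "k / 2 * \<rho> w \<le> dens w"
    using both by (intro dens_ge[OF w]) (simp add: eventually_conj_iff)
  show "dens w \<le> 2 * K * \<rho> w"
    using both by (intro dens_le[OF w]) (simp add: eventually_conj_iff)
qed

lemma dens_tail_0: "comparable (at_right 0) dens (\<lambda>w. w powr s2)"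
proof -
  obtain k K where k: "0 < k" "0 < K" "\<forall>\<^sub>F w in at_right 0. k * w powr s2 \<le> h w"
    "\<forall>\<^sub>F w in at_right 0. h w \<le> K * w powr s2"
    by (rule comparableE[OF h_tail_0])
  from eventually_conj[OF k(3,4)] obtain d where d: "0 < d"
    "\<And>w. 0 < w \<Longrightarrow> w < d \<Longrightarrow> k * w powr s2 \<le> h w \<and> h w \<le> K * w powr s2"
    by (auto simp: eventually_at_right_field)
  have ev: "\<forall>\<^sub>F w in at_right (0::real). w \<in> {0<..<min d 1}"
    by (rule eventually_at_right_real) (use d in simp)
  have *: "k / 2 * w powr s2 \<le> dens w \<and> dens w \<le> 2 * K * w powr s2" if "w \<in> {0<..<min d 1}" for w
  proof -
    have "\<forall>\<^sub>F u in nhds w. u \<in> {0<..<min d 1}" using that by (intro eventually_nhds_in_open) auto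
    then have "\<forall>\<^sub>F u in nhds w. k * u powr s2 \<le> h u \<and> h u \<le> K * u powr s2"
      by eventually_elim (use d(2) in auto)
    moreover have "isCont (\<lambda>u. u powr s2) w" using that by (intro continuous_intros) auto
    ultimately show ?thesis using that dens_between[of w "\<lambda>u. u powr s2" k K] k(1,2) by simp
  qed
  show ?thesis
  proof (rule comparableI[of "k/2" _ _ _ "2*K"])
    show "\<forall>\<^sub>F w in at_right 0. 0 < w powr s2" using ev by eventually_elim simp
    show "\<forall>\<^sub>F w in at_right 0. k / 2 * w powr s2 \<le> dens w" using ev by eventually_elim (use * in blast)
    show "\<forall>\<^sub>F w in at_right 0. dens w \<le> 2 * K * w powr s2" using ev by eventually_elim (use * in blast)
  qed (use k in simp)
qed

lemma dens_tail_1: "comparable (at_right 0) (\<lambda>w. dens (1 - w)) (\<lambda>w. w powr s1)"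
proof -
  obtain k K where k: "0 < k" "0 < K" "\<forall>\<^sub>F w in at_right 0. k * w powr s1 \<le> h (1 - w)"
    "\<forall>\<^sub>F w in at_right 0. h (1 - w) \<le> K * w powr s1"
    by (rule comparableE[OF h_tail_1])
  from eventually_conj[OF k(3,4)] obtain d where d: "0 < d"
    "\<And>w. 0 < w \<Longrightarrow> w < d \<Longrightarrow> k * w powr s1 \<le> h (1 - w) \<and> h (1 - w) \<le> K * w powr s1"
    by (auto simp: eventually_at_right_field)
  have ev: "\<forall>\<^sub>F w in at_right (0::real). w \<in> {0<..<min d 1}"
    by (rule eventually_at_right_real) (use d in simp)
  have *: "k / 2 * w powr s1 \<le> dens (1 - w) \<and> dens (1 - w) \<le> 2 * K * w powr s1" if "w \<in> {0<..<min d 1}" for w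
  proof -
    have "\<forall>\<^sub>F u in nhds (1 - w). u \<in> {1 - min d 1<..<1}" using that by (intro eventually_nhds_in_open) auto
    then have "\<forall>\<^sub>F u in nhds (1 - w). k * (1 - u) powr s1 \<le> h u \<and> h u \<le> K * (1 - u) powr s1"
    proof eventually_elim
      case (elim u)
      then show ?case using d(2)[of "1 - u"] by auto
    qed
    moreover have "isCont (\<lambda>u. (1 - u) powr s1) (1 - w)" using that by (intro continuous_intros) auto
    ultimately show ?thesis using that dens_between[of "1 - w" "\<lambda>u. (1 - u) powr s1" k K] k(1,2) by simp
  qed
  show ?thesis
  proof (rule comparableI[of "k/2" _ _ _ "2*K"])
    show "\<forall>\<^sub>F w in at_right 0. 0 < w powr s1" using ev by eventually_elim simp
    show "\<forall>\<^sub>F w in at_right 0. k / 2 * w powr s1 \<le> dens (1 - w)" using ev by eventually_elim (use * in blast)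
    show "\<forall>\<^sub>F w in at_right 0. dens (1 - w) \<le> 2 * K * w powr s1" using ev by eventually_elim (use * in blast)
  qed (use k in simp)
qed

lemma kernel_decay_less:
  assumes "exp_decay p a" "exp_decay q b" "0 \<le> a" "a < b"
  shows "exp_decay (\<lambda>t. kernel (p t) (q t)) ((1 + s2) * (b - a) - a)"
  using kernel_decay_aux[OF upper_near_0 lower_tail_0 dens_tail_0 assms] by (simp add: kernel_def)

lemma kernel_decay_greater:
  assumes "exp_decay p a" "exp_decay q b" "0 \<le> b" "b < a"
  shows "exp_decay (\<lambda>t. kernel (p t) (q t)) ((1 + s1) * (a - b) - b)"
proof -
  have eq: "\<forall>\<^sub>F t in at_top. lower (1 - p t / (q t + p t)) * upper (1 - p t / (q t + p t))
      + 2 * dens (1 - p t / (q t + p t)) * (q t * p t / (q t + p t) ^ 3) = kernel (p t) (q t)"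
    using exp_decay_pos[OF assms(1)] exp_decay_pos[OF assms(2)]
  proof eventually_elim
    case (elim t)
    then have "1 - p t / (q t + p t) = q t / (p t + q t)" by (simp add: field_simps)
    then show ?case by (simp only: kernel_def mult.commute[of "q t"] mult.commute[of "lower _"] add.commute[of "q t"])
  qed
  from kernel_decay_aux[OF lower_near_1 upper_tail_1 dens_tail_1 assms(2,1,3,4)] show ?thesis
    using eq by (rule exp_decay_eventually_eq)
qed

text \<open>If the spectral argument stays in a compact part of the open interval, only boundedness of the density
  away from 0 and infinity matters, and the mixed derivative term behaves like \<open>1 / (p + q)\<close>.\<close>
lemma kernel_decay_balanced:
  assumes "exp_decay p a" "exp_decay q a" "0 \<le> a"
    and \<delta>: "0 < \<delta>" "\<delta> < 1" "\<forall>\<^sub>F t in at_top. \<delta> \<le> q t / (p t + q t) \<and> q t / (p t + q t) \<le> 1 - \<delta>"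
    and m: "0 < m" "\<And>w. \<delta> \<le> w \<Longrightarrow> w \<le> 1 - \<delta> \<Longrightarrow> m \<le> dens w \<and> dens w \<le> M"
  shows "exp_decay (\<lambda>t. kernel (p t) (q t)) (- a)"
proof -
  let ?w = "\<lambda>t. q t / (p t + q t)"
  have "exp_decay (\<lambda>t. upper (?w t)) 0"
    by (rule exp_decay_comparable_1, rule comparableI[of "upper (1 - \<delta>)" _ _ _ 1]; (rule eventually_mono[OF \<delta>(3)])?)
      (use \<delta>(1,2) in \<open>auto intro: upper_pos upper_antimono upper_le_1\<close>)
  moreover have "exp_decay (\<lambda>t. lower (?w t)) 0"
    by (rule exp_decay_comparable_1, rule comparableI[of "lower \<delta>" _ _ _ 1]; (rule eventually_mono[OF \<delta>(3)])?)
      (use \<delta>(1,2) in \<open>auto intro: lower_pos lower_mono lower_le_1\<close>)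
  moreover have "exp_decay (\<lambda>t. dens (?w t)) 0"
    by (rule exp_decay_comparable_1, rule comparableI[of m _ _ _ M]; (rule eventually_mono[OF \<delta>(3)])?) (use m in auto)
  moreover have "exp_decay (\<lambda>_. 2) 0" by (rule exp_decay_tendsto[OF tendsto_const]) simp
  ultimately have "exp_decay (\<lambda>t. upper (?w t) * lower (?w t) + 2 * dens (?w t) * (p t * q t / (p t + q t) ^ 3))
    (min (0 + 0) (0 + 0 + (a + a - real 3 * min a a)))"
    by (intro exp_decay_add exp_decay_mult exp_decay_divide exp_decay_power assms(1,2))
  with \<open>0 \<le> a\<close> show ?thesis by (simp add: kernel_def)
qed

text \<open>Since \<open>max p q \<le> stdf p q \<le> p + q\<close>, the exponent lies between 0 and \<open>min p q\<close>.\<close>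
lemma exp_factor_tendsto:
  assumes pos: "\<forall>\<^sub>F t in F. 0 < p t \<and> 0 < q t" and q: "(q \<longlongrightarrow> 0) F"
  shows "((\<lambda>t. exp (p t + q t - stdf (p t) (q t))) \<longlongrightarrow> 1) F"
proof -
  have "((\<lambda>t. p t + q t - stdf (p t) (q t)) \<longlongrightarrow> 0) F"
  proof (rule real_tendsto_sandwich[OF _ _ tendsto_const q])
    show "\<forall>\<^sub>F t in F. 0 \<le> p t + q t - stdf (p t) (q t)"
      using pos by eventually_elim (simp add: stdf_le)
    show "\<forall>\<^sub>F t in F. p t + q t - stdf (p t) (q t) \<le> q t"
      by (simp add: stdf_ge_left)
  qed
  from tendsto_exp[OF this] show ?thesis by simp
qed

lemma copula_density_decay:
  assumes uv: "\<forall>\<^sub>F t in at_top. 0 < u t \<and> u t < 1 \<and> 0 < v t \<and> v t < 1"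
    and v: "exp_decay (\<lambda>t. - ln (v t)) b" "0 < b"
    and k: "exp_decay (\<lambda>t. kernel (- ln (u t)) (- ln (v t))) r"
  shows "exp_decay (\<lambda>t. copula_density C (u t) (v t)) r"
proof -
  have "exp_decay (\<lambda>t. exp (- ln (u t) + - ln (v t) - stdf (- ln (u t)) (- ln (v t)))) 0"
  proof (rule exp_decay_tendsto[OF exp_factor_tendsto])
    show "\<forall>\<^sub>F t in at_top. 0 < - ln (u t) \<and> 0 < - ln (v t)" using uv by eventually_elim simp
    show "((\<lambda>t. - ln (v t)) \<longlongrightarrow> 0) at_top"
      using exp_decay_filterlim[OF v] by (simp add: filterlim_at)
  qed simp
  from exp_decay_mult[OF this k]
  have "exp_decay (\<lambda>t. exp (- ln (u t) + - ln (v t) - stdf (- ln (u t)) (- ln (v t)))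
    * kernel (- ln (u t)) (- ln (v t))) r" by (simp only: add_0)
  moreover have "\<forall>\<^sub>F t in at_top. exp (- ln (u t) + - ln (v t) - stdf (- ln (u t)) (- ln (v t)))
    * kernel (- ln (u t)) (- ln (v t)) = copula_density C (u t) (v t)"
    using uv by eventually_elim (simp only: ev_copula_density)
  ultimately show ?thesis by (rule exp_decay_eventually_eq)
qed

end

section \<open>Pair copulas along a ray\<close>

lemma exp_cdf_bounds: "0 < x \<Longrightarrow> 0 < exp_cdf x \<and> exp_cdf x < 1"
  by (simp add: exp_cdf_def)

lemma exp_tail_filterlim: "0 < (c::real) \<Longrightarrow> filterlim (\<lambda>t. exp (- (c * t))) (at_right 0) at_top"
  by (rule exp_decay_filterlim[OF exp_decay_exp])

lemma margin_comparable:
  assumes "0 < x"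
  shows "comparable at_top (\<lambda>t. - ln (exp_cdf (t * x))) (\<lambda>t. exp (- (x * t)))"
  using comparable_neg_ln[OF exp_tail_filterlim[OF assms]] by (simp add: exp_cdf_def mult.commute)

lemma margin_decay: "0 < x \<Longrightarrow> exp_decay (\<lambda>t. - ln (exp_cdf (t * x))) x"
  by (rule exp_decay_comparable[OF margin_comparable exp_decay_exp])

lemma margins_bounds:
  assumes "0 < x" "0 < y"
  shows "\<forall>\<^sub>F t in at_top. 0 < exp_cdf (t * x) \<and> exp_cdf (t * x) < 1 \<and> 0 < exp_cdf (t * y) \<and> exp_cdf (t * y) < 1"
  using eventually_gt_at_top[of 0] by eventually_elim (use assms in \<open>simp add: exp_cdf_bounds\<close>)

context spectral_tail begin

lemma margin_density_decay_less:
  assumes "0 < x" "x < y"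
  shows "exp_decay (\<lambda>t. copula_density C (exp_cdf (t * x)) (exp_cdf (t * y))) ((1 + s2) * (y - x) - x)"
  by (rule copula_density_decay[OF margins_bounds margin_decay _ kernel_decay_less[OF margin_decay margin_decay]])
    (use assms in auto)

lemma margin_density_decay_greater:
  assumes "0 < y" "y < x"
  shows "exp_decay (\<lambda>t. copula_density C (exp_cdf (t * x)) (exp_cdf (t * y))) ((1 + s1) * (x - y) - y)"
  by (rule copula_density_decay[OF margins_bounds margin_decay _ kernel_decay_greater[OF margin_decay margin_decay]])
    (use assms in auto)

lemma dens_pos_of_isCont:
  assumes "0 < w" "w < 1" "isCont h w" "0 < h w"
  shows "0 < dens w"
proof -
  have "(h \<longlongrightarrow> h w) (nhds w)" using assms(3) by (simp add: isCont_def tendsto_at_iff_tendsto_nhds)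
  then have "\<forall>\<^sub>F u in nhds w. h w / 2 < h u" by (rule order_tendstoD) (use assms in simp)
  then have "h w / 2 \<le> dens w" by (intro dens_ge[OF assms(1,2)]) (auto elim: eventually_mono)
  with assms(4) show ?thesis by simp
qed

lemma margin_density_decay_eq:
  assumes "0 < x" "isCont h (1 / 2)" "0 < h (1 / 2)"
  shows "exp_decay (\<lambda>t. copula_density C (exp_cdf (t * x)) (exp_cdf (t * x))) (- x)"
proof (rule copula_density_decay[OF margins_bounds margin_decay])
  let ?p = "\<lambda>t. - ln (exp_cdf (t * x))"
  have "\<forall>\<^sub>F t in at_top. ?p t / (?p t + ?p t) = 1 / 2"
    using exp_decay_pos[OF margin_decay[OF assms(1)]] by eventually_elim (simp add: field_simps)
  then have ev: "\<forall>\<^sub>F t in at_top. 1/2 \<le> ?p t / (?p t + ?p t) \<and> ?p t / (?p t + ?p t) \<le> 1 - 1/2"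
    by eventually_elim simp
  have "dens (1/2) \<le> dens w \<and> dens w \<le> dens (1/2)" if "1/2 \<le> w" "w \<le> 1 - 1/2" for w
  proof -
    have w: "w = 1/2" using that by simp
    show ?thesis unfolding w by simp
  qed
  with dens_pos_of_isCont[OF _ _ assms(2,3)] assms(1)
  show "exp_decay (\<lambda>t. kernel (?p t) (?p t)) (- x)"
    by (intro kernel_decay_balanced[OF margin_decay margin_decay _ _ _ ev]) auto
qed (use assms in auto)

lemma conditional_bounds:
  assumes "0 < u" "u < 1" "0 < v" "v < 1"
  shows "0 < partial2 C u v" "partial2 C u v < 1"
proof -
  define p q where "p = - ln u" and "q = - ln v"
  have pq: "0 < p" "0 < q" using assms by (auto simp: p_def q_def)
  then have w: "0 < q / (p + q)" "q / (p + q) < 1" by auto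
  have eq: "partial2 C u v = exp (q - stdf p q) * lower (q / (p + q))"
    using assms by (simp add: partial2_ev_copula p_def q_def)
  show "0 < partial2 C u v" using w by (simp add: eq lower_pos)
  have "exp (q - stdf p q) * lower (q / (p + q)) \<le> 1 * lower (q / (p + q))"
    using w stdf_ge_right[of q p] by (intro mult_right_mono) (auto intro: lower_nonneg)
  also have "\<dots> < 1" using w by (simp add: lower_less_1)
  finally show "partial2 C u v < 1" by (simp add: eq)
qed

lemma neg_ln_conditional:
  assumes "0 < u" "u < 1" "0 < v" "v < 1"
  defines "p \<equiv> - ln u" and "q \<equiv> - ln v"
  shows "- ln (partial2 C u v) = - ln (lower (q / (p + q))) + (stdf p q - q)"
proof -
  have pq: "0 < p" "0 < q" using assms by auto
  then have "0 < lower (q / (p + q))" by (intro lower_pos) auto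
  moreover have "partial2 C u v = exp (q - stdf p q) * lower (q / (p + q))"
    using assms by (simp add: partial2_ev_copula)
  ultimately show ?thesis by (simp add: ln_mult)
qed

text \<open>For \<open>x < y\<close> the conditional distribution function tends to 0 exponentially fast, and minus its
  logarithm grows linearly; for \<open>x = y\<close> it tends to \<open>lower (1 / 2)\<close>, which lies strictly between 0
  and 1.\<close>
lemma conditional_decay_le:
  assumes "0 < x" "x \<le> y"
  shows "exp_decay (\<lambda>t. - ln (partial2 C (exp_cdf (t * x)) (exp_cdf (t * y)))) 0"
proof -
  let ?p = "\<lambda>t. - ln (exp_cdf (t * x))" and ?q = "\<lambda>t. - ln (exp_cdf (t * y))"
  let ?U = "\<lambda>t. partial2 C (exp_cdf (t * x)) (exp_cdf (t * y))"
  let ?w = "\<lambda>t. ?q t / (?p t + ?q t)"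
  have "0 < y" using assms by simp
  have p: "exp_decay ?p x" and q: "exp_decay ?q y" using assms by (auto intro: margin_decay)
  have eq: "\<forall>\<^sub>F t in at_top. exp (?q t - stdf (?p t) (?q t)) * lower (?w t) = ?U t"
    using margins_bounds[OF \<open>0 < x\<close> \<open>0 < y\<close>] by eventually_elim (simp only: partial2_ev_copula)
  have "((\<lambda>t. ?q t - stdf (?p t) (?q t)) \<longlongrightarrow> - 0) at_top"
  proof (rule real_tendsto_sandwich)
    show "\<forall>\<^sub>F t in at_top. - ?p t \<le> ?q t - stdf (?p t) (?q t)"
      using exp_decay_pos[OF p] exp_decay_pos[OF q]
    proof eventually_elim
      case (elim t)
      from stdf_le[OF elim] show ?case by linarith
    qed
    show "\<forall>\<^sub>F t in at_top. ?q t - stdf (?p t) (?q t) \<le> 0"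
      by (intro always_eventually allI) (simp only: diff_le_0_iff_le stdf_ge_right)
    show "((\<lambda>t. - ?p t) \<longlongrightarrow> - 0) at_top"
      using exp_decay_filterlim[OF p \<open>0 < x\<close>] by (intro tendsto_minus) (simp add: filterlim_at)
  qed simp
  then have E: "((\<lambda>t. exp (?q t - stdf (?p t) (?q t))) \<longlongrightarrow> exp 0) at_top"
    by (intro tendsto_exp) simp
  show ?thesis
  proof (cases "x < y")
    case True
    have "exp_decay ?w (y - min x y)" by (intro exp_decay_divide exp_decay_add p q)
    then have w: "exp_decay ?w (y - x)" using True by simp
    have "exp_decay (\<lambda>t. exp (?q t - stdf (?p t) (?q t)) * lower (?w t)) (0 + (1 + s2) * (y - x))"
      using True by (intro exp_decay_mult exp_decay_tendsto[OF E] exp_decay_compose[OF lower_tail_0 w]) auto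
    then have "exp_decay ?U (0 + (1 + s2) * (y - x))" using eq by (rule exp_decay_eventually_eq)
    then show ?thesis by (rule exp_decay_neg_ln) (use True s2 in simp)
  next
    case False
    with assms have "y = x" by simp
    have "\<forall>\<^sub>F t in at_top. exp (?q t - stdf (?p t) (?q t)) * lower (1/2) = ?U t"
      using eq exp_decay_pos[OF p] by eventually_elim (simp add: \<open>y = x\<close> field_simps)
    from Lim_transform_eventually[OF tendsto_mult[OF E tendsto_const] this]
    have U: "(?U \<longlongrightarrow> lower (1/2)) at_top" by simp
    have l: "0 < lower (1/2)" "lower (1/2) < 1" by (auto intro: lower_pos lower_less_1)
    have "((\<lambda>t. - ln (?U t)) \<longlongrightarrow> - ln (lower (1/2))) at_top"
      using l by (intro tendsto_minus tendsto_ln U) auto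
    then show ?thesis by (rule exp_decay_tendsto) (use l in simp)
  qed
qed

text \<open>Here the conditional distribution function tends to 1. By \<open>neg_ln_conditional\<close> minus its logarithm
  is the sum of \<open>- ln (lower w)\<close>, which is comparable to \<open>1 - lower w\<close> and hence to
  \<open>(1 - w) powr (2 + s1)\<close>, and of \<open>stdf p q - q\<close>, which is at most \<open>upper w * p\<close> and thus smaller
  by the factor \<open>exp (- y * t)\<close>.\<close>
lemma conditional_comparable_greater:
  assumes "0 < y" "y < x"
  shows "comparable at_top (\<lambda>t. - ln (partial2 C (exp_cdf (t * x)) (exp_cdf (t * y))))
    (\<lambda>t. exp (- ((2 + s1) * (x - y) * t)))"
proof -
  let ?p = "\<lambda>t. - ln (exp_cdf (t * x))" and ?q = "\<lambda>t. - ln (exp_cdf (t * y))"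
  let ?w = "\<lambda>t. ?q t / (?p t + ?q t)" and ?z = "\<lambda>t. ?p t / (?q t + ?p t)"
  let ?a = "(2 + s1) * (x - y)"
  have "0 < x" and a: "0 < ?a" using assms s1 by auto
  have p: "comparable at_top ?p (\<lambda>t. exp (- (x * t)))" and q: "comparable at_top ?q (\<lambda>t. exp (- (y * t)))"
    using assms by (auto intro: margin_comparable)
  obtain K where K: "0 < K" "\<forall>\<^sub>F t in at_top. ?p t \<le> K * exp (- (x * t))" "\<forall>\<^sub>F t in at_top. 0 < ?p t"
    by (rule comparableE[OF p])
  have "comparable at_top (\<lambda>t. ?q t + ?p t) (\<lambda>t. exp (- (y * t)))"
  proof (rule comparable_add_small[OF q])
    show "\<forall>\<^sub>F t in at_top. 0 \<le> ?p t" using K(3) by eventually_elim simp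
    show "\<forall>\<^sub>F t in at_top. ?p t \<le> K * exp (- (y * t))" using K(2) eventually_gt_at_top[of 0]
    proof eventually_elim
      case (elim t)
      have "K * exp (- (x * t)) \<le> K * exp (- (y * t))" using elim(2) K(1) assms by simp
      with elim show ?case by linarith
    qed
  qed
  from comparable_divide[OF p this]
  have "comparable at_top ?z (\<lambda>t. exp (- (x * t)) / exp (- (y * t)))" .
  then have z: "comparable at_top ?z (\<lambda>t. exp (- ((x - y) * t)))"
    by (rule comparable_eventually_eq) (simp_all add: exp_diff[symmetric] left_diff_distrib)
  have z0: "filterlim ?z (at_right 0) at_top"
    by (rule exp_decay_filterlim[OF exp_decay_comparable[OF z exp_decay_exp]]) (use assms in simp)
  have zw: "\<forall>\<^sub>F t in at_top. 1 - ?z t = ?w t"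
    using K(3) comparable_pos[OF q] by eventually_elim (simp add: field_simps)
  have z_powr: "comparable at_top (\<lambda>t. ?z t powr s) (\<lambda>t. exp (- (s * (x - y) * t)))" for s
    using comparable_powr[OF z, of s] by (simp add: exp_powr_real ac_simps)
  have "comparable at_top (\<lambda>t. 1 - lower (1 - ?z t)) (\<lambda>t. exp (- (?a * t)))"
    by (rule comparable_trans[OF comparable_compose[OF lower_tail_1 z0] z_powr])
  then have e: "comparable at_top (\<lambda>t. 1 - lower (?w t)) (\<lambda>t. exp (- (?a * t)))"
    by (rule comparable_eventually_eq) (use zw in \<open>auto elim: eventually_mono\<close>)
  have "filterlim (\<lambda>t. 1 - lower (?w t)) (at_right 0) at_top"
    by (rule exp_decay_filterlim[OF exp_decay_comparable[OF e exp_decay_exp] a])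
  from comparable_trans[OF comparable_neg_ln[OF this] e]
  have main: "comparable at_top (\<lambda>t. - ln (lower (?w t))) (\<lambda>t. exp (- (?a * t)))" by simp
  have "comparable at_top (\<lambda>t. upper (1 - ?z t) * ?p t) (\<lambda>t. exp (- ((1 + s1) * (x - y) * t)) * exp (- (x * t)))"
    by (rule comparable_mult[OF comparable_trans[OF comparable_compose[OF upper_tail_1 z0] z_powr] p])
  then have up: "comparable at_top (\<lambda>t. upper (?w t) * ?p t) (\<lambda>t. exp (- ((1 + s1) * (x - y) * t)) * exp (- (x * t)))"
    by (rule comparable_eventually_eq) (use zw in \<open>auto elim: eventually_mono\<close>)
  obtain L where L: "0 < L"
    "\<forall>\<^sub>F t in at_top. upper (?w t) * ?p t \<le> L * (exp (- ((1 + s1) * (x - y) * t)) * exp (- (x * t)))"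
    by (rule comparableE[OF up])
  have "comparable at_top (\<lambda>t. - ln (lower (?w t)) + (stdf (?p t) (?q t) - ?q t)) (\<lambda>t. exp (- (?a * t)))"
  proof (rule comparable_add_small[OF main])
    show "\<forall>\<^sub>F t in at_top. 0 \<le> stdf (?p t) (?q t) - ?q t"
      by (intro always_eventually allI) (simp only: diff_ge_0_iff_ge stdf_ge_right)
    show "\<forall>\<^sub>F t in at_top. stdf (?p t) (?q t) - ?q t \<le> L * exp (- (?a * t))"
      using L(2) K(3) comparable_pos[OF q] eventually_gt_at_top[of 0]
    proof eventually_elim
      case (elim t)
      have w: "0 \<le> ?w t" "?w t \<le> 1" using elim by (auto simp: divide_simps)
      have "lower (?w t) * ?q t \<le> 1 * ?q t" using elim lower_le_1[OF w] by (intro mult_right_mono) auto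
      then have "stdf (?p t) (?q t) - ?q t \<le> upper (?w t) * ?p t"
        using stdf_eq_upper_lower[OF elim(2,3)] by linarith
      also have "\<dots> \<le> L * exp (- ((1 + s1) * (x - y) * t) - x * t)" using elim(1) by (simp add: exp_add[symmetric])
      also have "\<dots> \<le> L * exp (- (?a * t))"
        using L(1) elim(4) assms by (simp add: algebra_simps)
      finally show ?case .
    qed
  qed
  then show ?thesis
  proof (rule comparable_eventually_eq)
    show "\<forall>\<^sub>F t in at_top. - ln (lower (?w t)) + (stdf (?p t) (?q t) - ?q t)
      = - ln (partial2 C (exp_cdf (t * x)) (exp_cdf (t * y)))"
      using margins_bounds[OF \<open>0 < x\<close> \<open>0 < y\<close>] by eventually_elim (simp only: neg_ln_conditional)
  qed simp
qed

lemma stdf_gt_left: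
  assumes "0 < p" "0 < q"
  shows "p < stdf p q"
proof -
  have "stdf p (q / 2) < stdf p q"
  proof (rule DERIV_pos_imp_increasing[where f = "stdf p"])
    fix r assume "q / 2 \<le> r" "r \<le> q"
    then have "0 < r" using assms by simp
    with assms show "\<exists>y. (stdf p has_real_derivative y) (at r) \<and> 0 < y"
      by (intro exI[of _ "lower (r / (p + r))"] conjI stdf_deriv2 lower_pos) auto
  qed (use assms in simp)
  with stdf_ge_left[of p "q / 2"] show ?thesis by simp
qed

lemma exp_cdf_survival: "- ln (1 - exp_cdf x) = x"
  by (simp add: exp_cdf_def)

text \<open>The exponential margins turn the arguments of the underlying extreme value copula into
  \<open>p = t * x\<close> and \<open>q = t * y\<close>, so that \<open>w\<close> does not depend on \<open>t\<close> and homogeneity makes the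
  conditional distribution function an explicit exponential.\<close>
lemma inverted_conditional_comparable:
  assumes "0 < x" "0 < y"
  defines "W \<equiv> \<lambda>t. partial1 C_inv (exp_cdf (t * x)) (exp_cdf (t * y))"
  shows "comparable at_top (\<lambda>t. - ln (W t)) (\<lambda>t. exp (- ((stdf x y - x) * t)))"
    and "\<forall>\<^sub>F t in at_top. 0 < W t \<and> W t < 1"
proof -
  let ?w = "y / (x + y)" and ?b = "stdf x y - x"
  let ?e = "\<lambda>t. upper ?w * exp (- (?b * t))"
  have w: "0 \<le> ?w" "?w < 1" using assms by auto
  have b: "0 < ?b" using stdf_gt_left[OF assms(1,2)] by simp
  have "comparable at_top ?e (\<lambda>t. 1 * exp (- (?b * t)))"
    by (intro comparable_mult comparable_const comparableI[of 1 _ _ _ 1] upper_pos w) auto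
  then have e: "comparable at_top ?e (\<lambda>t. exp (- (?b * t)))" by simp
  have lim: "filterlim ?e (at_right 0) at_top"
    by (rule exp_decay_filterlim[OF exp_decay_comparable[OF e exp_decay_exp] b])
  have W: "\<forall>\<^sub>F t in at_top. 1 - ?e t = W t"
    using eventually_gt_at_top[of 0]
  proof eventually_elim
    case (elim t)
    have "W t = 1 - partial1 C (1 - exp_cdf (t * x)) (1 - exp_cdf (t * y))"
      unfolding W_def using exp_cdf_bounds[of "t * x"] exp_cdf_bounds[of "t * y"] elim assms
      by (intro partial1_inverted_ev_copula) auto
    also have "\<dots> = 1 - exp (t * x - stdf (t * x) (t * y)) * upper (t * y / (t * x + t * y))"
      using exp_cdf_bounds[of "t * x"] exp_cdf_bounds[of "t * y"] elim assms
      by (subst partial1_ev_copula) (auto simp only: exp_cdf_survival diff_gt_0_iff_gt mult_pos_pos, auto)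
    also have "t * y / (t * x + t * y) = ?w" using elim by (simp add: distrib_left[symmetric])
    also have "stdf (t * x) (t * y) = t * stdf x y" using elim by (simp add: stdf_homogeneous)
    finally show ?case by (simp add: algebra_simps)
  qed
  from comparable_trans[OF comparable_neg_ln[OF lim] e]
  show "comparable at_top (\<lambda>t. - ln (W t)) (\<lambda>t. exp (- (?b * t)))"
    by (rule comparable_eventually_eq) (use W in \<open>auto elim: eventually_mono\<close>)
  have "\<forall>\<^sub>F s in at_right (0::real). s \<in> {0<..<1}" by (rule eventually_at_right_real) simp
  from eventually_compose_filterlim[OF this lim] W
  show "\<forall>\<^sub>F t in at_top. 0 < W t \<and> W t < 1"
    by eventually_elim (auto simp del: mult_eq_0_iff)
qed

text \<open>The kernel equals a positive constant plus a multiple of \<open>1 / t\<close>, so the rate is that of the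
  exponential factor.\<close>
lemma inverted_density_decay:
  assumes "0 < x" "0 < y"
  shows "exp_decay (\<lambda>t. copula_density C_inv (exp_cdf (t * x)) (exp_cdf (t * y))) (stdf x y - x - y)"
proof -
  let ?w = "y / (x + y)"
  let ?A = "upper ?w * lower ?w" and ?B = "2 * dens ?w * (x * y / (x + y) ^ 3)"
  have w: "0 < ?w" "?w < 1" using assms by auto
  have "((\<lambda>t. c + d / t) \<longlongrightarrow> c) at_top" for c d :: real by real_asymp
  then have "exp_decay (\<lambda>t. ?A + ?B / t) 0"
    by (rule exp_decay_tendsto) (use w in \<open>simp add: upper_pos lower_pos\<close>)
  from exp_decay_mult[OF exp_decay_exp this]
  have "exp_decay (\<lambda>t. exp (- ((stdf x y - x - y) * t)) * (?A + ?B / t)) (stdf x y - x - y)" by simp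
  then show ?thesis
  proof (rule exp_decay_eventually_eq)
    show "\<forall>\<^sub>F t in at_top. exp (- ((stdf x y - x - y) * t)) * (?A + ?B / t)
      = copula_density C_inv (exp_cdf (t * x)) (exp_cdf (t * y))"
      using eventually_gt_at_top[of 0]
    proof eventually_elim
      case (elim t)
      have bounds: "0 < exp_cdf (t * x)" "exp_cdf (t * x) < 1" "0 < exp_cdf (t * y)" "exp_cdf (t * y) < 1"
        using exp_cdf_bounds[of "t * x"] exp_cdf_bounds[of "t * y"] elim assms by auto
      have "copula_density C_inv (exp_cdf (t * x)) (exp_cdf (t * y))
        = copula_density C (1 - exp_cdf (t * x)) (1 - exp_cdf (t * y))"
        by (rule inverted_ev_copula_density[OF bounds])
      also have "\<dots> = exp (t * x + t * y - stdf (t * x) (t * y)) * kernel (t * x) (t * y)"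
        using bounds by (subst ev_copula_density) (auto simp: exp_cdf_survival[simplified])
      also have "stdf (t * x) (t * y) = t * stdf x y" using elim by (simp add: stdf_homogeneous)
      also have "t * y / (t * x + t * y) = ?w" using elim by (simp add: distrib_left[symmetric])
      then have "kernel (t * x) (t * y) = ?A + 2 * dens ?w * (t * x * (t * y) / (t * x + t * y) ^ 3)"
        by (simp only: kernel_def)
      also have "t * x * (t * y) / (t * x + t * y) ^ 3 = x * y / (x + y) ^ 3 / t"
        using elim assms by (simp add: distrib_left[symmetric] power_mult_distrib power3_eq_cube)
      finally show ?case by (simp add: algebra_simps)
    qed
  qed
qed

end

section \<open>The gauge function of the vine\<close>

lemma exp_decay_imp_asymp_equiv:
  assumes "exp_decay f r" "0 < r"
  shows "asymp_equiv (\<lambda>t. - ln (f t)) at_top (\<lambda>t. t * r)"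
proof (rule asymp_equivI')
  have "((\<lambda>t. - ln (f t) / t / r) \<longlongrightarrow> r / r) at_top"
    using assms by (intro tendsto_divide tendsto_const) (auto simp: exp_decay_def)
  with \<open>0 < r\<close> show "((\<lambda>t. - ln (f t) / (t * r)) \<longlongrightarrow> 1) at_top" by simp
qed

lemma vine_density_decay:
  fixes c12 c23 c13 :: "real \<Rightarrow> real \<Rightarrow> real"
  assumes "exp_decay (\<lambda>t. copula_density c12 (exp_cdf (t * x1)) (exp_cdf (t * x2))) r12"
    and "exp_decay (\<lambda>t. copula_density c23 (exp_cdf (t * x2)) (exp_cdf (t * x3))) r23"
    and "exp_decay (\<lambda>t. copula_density c13 (partial2 c12 (exp_cdf (t * x1)) (exp_cdf (t * x2)))
      (partial1 c23 (exp_cdf (t * x2)) (exp_cdf (t * x3)))) r13"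
  shows "exp_decay (\<lambda>t. vine_density c12 c23 c13 (t *\<^sub>R (x1, x2, x3))) (x1 + x2 + x3 + r12 + r23 + r13)"
proof -
  have m: "exp_decay (\<lambda>t. exp (- (t * x))) x" for x
    using exp_decay_exp[of x] by (simp add: mult.commute)
  show ?thesis
    unfolding scaleR_prod_def
    by (simp only: vine_density.simps fst_conv snd_conv real_scaleR_def)
      (intro exp_decay_mult m assms)
qed

text \<open>If \<open>l \<le> q / p \<le> L\<close>, then \<open>q / (p + q) \<ge> l / (1 + L)\<close> and \<open>p / (p + q) \<ge> 1 / (1 + L)\<close>.\<close>
lemma comparable_imp_balanced:
  assumes p: "comparable F p g" and q: "comparable F q g"
  obtains \<delta> where "0 < \<delta>" "\<delta> < 1"
    "\<forall>\<^sub>F x in F. \<delta> \<le> q x / (p x + q x) \<and> q x / (p x + q x) \<le> 1 - (\<delta>::real)"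
proof -
  have "comparable F (\<lambda>x. g x / g x) (\<lambda>_. 1)"
    by (rule comparableI[of 1 _ _ _ 1]) (use comparable_pos_right[OF p] in \<open>auto elim: eventually_mono\<close>)
  from comparableE[OF comparable_trans[OF comparable_divide[OF q p] this]]
  obtain l L where l: "0 < l" "0 < L" "\<forall>\<^sub>F x in F. l * 1 \<le> q x / p x" "\<forall>\<^sub>F x in F. q x / p x \<le> L * 1"
    by metis
  define \<delta> where "\<delta> = min l 1 / (1 + L)"
  have d: "0 < \<delta>" "\<delta> < 1" using l by (auto simp: \<delta>_def min_def divide_simps)
  have "\<forall>\<^sub>F x in F. \<delta> \<le> q x / (p x + q x) \<and> q x / (p x + q x) \<le> 1 - \<delta>"
    using l(3,4) comparable_pos[OF p] comparable_pos[OF q]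
  proof eventually_elim
    case (elim x)
    define r where "r = q x / p x"
    have r: "l \<le> r" "r \<le> L" "0 < r" "q x = r * p x" using elim by (auto simp: r_def)
    have "q x / (p x + q x) = (r * p x) / ((1 + r) * p x)" by (simp add: r(4) distrib_right)
    then have w: "q x / (p x + q x) = r / (1 + r)"
      using elim by (simp only: mult_divide_mult_cancel_right)
    have w': "1 - r / (1 + r) = 1 / (1 + r)" using r(3) by (simp add: field_simps)
    have "\<delta> \<le> r / (1 + r)" "\<delta> \<le> 1 / (1 + r)"
      unfolding \<delta>_def using r l by (auto intro!: frac_le)
    with w w' show ?case by linarith
  qed
  with d that show ?thesis by blast
qed

lemma (in spectral_tail) dens_bounds_compact:
  assumes cont: "continuous_on {0<..<1} h" and pos: "\<forall>w\<in>{0<..<1}. 0 < h w"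
    and d: "0 < \<delta>" "\<delta> < 1"
  obtains m M where "0 < m" "\<And>w. \<delta> \<le> w \<Longrightarrow> w \<le> 1 - \<delta> \<Longrightarrow> m \<le> dens w \<and> dens w \<le> M"
proof -
  let ?K = "{\<delta>/2..1 - \<delta>/2}"
  have K: "?K \<noteq> {}" "?K \<subseteq> {0<..<1}" using d by auto
  then have cont: "continuous_on ?K h" using cont by (blast intro: continuous_on_subset)
  obtain y where y: "y \<in> ?K" "\<And>w. w \<in> ?K \<Longrightarrow> h y \<le> h w"
    using continuous_attains_inf[OF compact_Icc K(1) cont] by blast
  obtain z where z: "z \<in> ?K" "\<And>w. w \<in> ?K \<Longrightarrow> h w \<le> h z"
    using continuous_attains_sup[OF compact_Icc K(1) cont] by blast
  show ?thesis
  proof (rule that[of "h y" "h z"])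
    show "0 < h y" using y(1) K(2) pos by blast
    fix w assume w: "\<delta> \<le> w" "w \<le> 1 - \<delta>"
    have ev: "\<forall>\<^sub>F u in nhds w. u \<in> {\<delta>/2<..<1 - \<delta>/2}"
      using w d by (intro eventually_nhds_in_open) auto
    have "\<forall>\<^sub>F u in nhds w. h y \<le> h u" using ev by eventually_elim (use y(2) in auto)
    moreover have "\<forall>\<^sub>F u in nhds w. h u \<le> h z" using ev by eventually_elim (use z(2) in auto)
    ultimately show "h y \<le> dens w \<and> dens w \<le> h z"
      using w d dens_ge[of w] dens_le[of w] by simp
  qed
qed

locale vine_tail =
  S12: spectral_tail H12 h12 s1_12 s2_12 + S23: spectral_tail H23 h23 s1_23 s2_23 +
  S13: spectral_tail H13 h13 s1_13 s2_13
  for H12 H23 H13 h12 h23 h13 s1_12 s2_12 s1_23 s2_23 s1_13 s2_13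
begin

abbreviation vine where
  "vine \<equiv> vine_density (ev_copula (exponent_measure H12)) (inverted_ev_copula (exponent_measure H23))
     (ev_copula (exponent_measure H13))"

context
  fixes x1 x2 x3 :: real
  assumes pos: "0 < x1" "0 < x2" "0 < x3"
begin

abbreviation (input) excess where "excess \<equiv> S23.stdf x2 x3 - x2"

lemma excess_pos: "0 < excess"
  using S23.stdf_gt_left[of x2 x3] pos by simp

definition U where "U t = partial2 S12.C (exp_cdf (t * x1)) (exp_cdf (t * x2))"
definition W where "W t = partial1 S23.C_inv (exp_cdf (t * x2)) (exp_cdf (t * x3))"

lemma UW_bounds: "\<forall>\<^sub>F t in at_top. 0 < U t \<and> U t < 1 \<and> 0 < W t \<and> W t < 1"
  using margins_bounds[OF pos(1,2)] S23.inverted_conditional_comparable(2)[OF pos(2,3)]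
  by eventually_elim (simp add: U_def W_def S12.conditional_bounds)

lemma W_comparable: "comparable at_top (\<lambda>t. - ln (W t)) (\<lambda>t. exp (- (excess * t)))"
  unfolding W_def by (rule S23.inverted_conditional_comparable(1)[OF pos(2,3)])

lemma W_decay: "exp_decay (\<lambda>t. - ln (W t)) excess"
  by (rule exp_decay_comparable[OF W_comparable exp_decay_exp])

lemma vine_decay:
  assumes "exp_decay (\<lambda>t. copula_density S12.C (exp_cdf (t * x1)) (exp_cdf (t * x2))) r12"
    and "exp_decay (\<lambda>t. S13.kernel (- ln (U t)) (- ln (W t))) r13"
  shows "exp_decay (\<lambda>t. vine (t *\<^sub>R (x1, x2, x3))) (x1 + x2 + r12 + excess + r13)"
proof -
  have "exp_decay (\<lambda>t. copula_density S13.C (U t) (W t)) r13"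
    by (rule S13.copula_density_decay[OF UW_bounds W_decay excess_pos assms(2)])
  from vine_density_decay[OF assms(1) S23.inverted_density_decay[OF pos(2,3)] this[unfolded U_def W_def]]
  show ?thesis by (simp add: algebra_simps)
qed

lemma vine_decay_le:
  assumes "x1 \<le> x2" "x1 = x2 \<Longrightarrow> isCont h12 (1/2) \<and> 0 < h12 (1/2)"
  shows "exp_decay (\<lambda>t. vine (t *\<^sub>R (x1, x2, x3))) (x2 + (1 + s2_12) * (x2 - x1) + (2 + s2_13) * excess)"
proof -
  have "exp_decay (\<lambda>t. copula_density S12.C (exp_cdf (t * x1)) (exp_cdf (t * x2))) ((1 + s2_12) * (x2 - x1) - x1)"
  proof (cases "x1 = x2")
    case True
    then show ?thesis using S12.margin_density_decay_eq[OF pos(1)] assms(2) by simp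
  next
    case False
    then show ?thesis using S12.margin_density_decay_less[OF pos(1)] assms(1) by simp
  qed
  moreover have "exp_decay (\<lambda>t. - ln (U t)) 0"
    unfolding U_def by (rule S12.conditional_decay_le[OF pos(1) assms(1)])
  from S13.kernel_decay_less[OF this W_decay _ excess_pos]
  have "exp_decay (\<lambda>t. S13.kernel (- ln (U t)) (- ln (W t))) ((1 + s2_13) * excess)" by simp
  ultimately have "exp_decay (\<lambda>t. vine (t *\<^sub>R (x1, x2, x3)))
    (x1 + x2 + ((1 + s2_12) * (x2 - x1) - x1) + excess + (1 + s2_13) * excess)" by (rule vine_decay)
  moreover have "x1 + x2 + ((1 + s2_12) * (x2 - x1) - x1) + excess + (1 + s2_13) * excess
    = x2 + (1 + s2_12) * (x2 - x1) + (2 + s2_13) * excess"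
    by (simp add: algebra_simps)
  ultimately show ?thesis by (simp only:)
qed

text \<open>With \<open>max 0 (a - b)\<close> and \<open>max 0 (b - a)\<close> the two cases of the gauge function become one expression,
  which is visibly continuous across the surface \<open>a = b\<close> and positive.\<close>
lemma vine_decay_gt:
  defines "a \<equiv> (2 + s1_12) * (x1 - x2)"
  assumes less: "x2 < x1"
    and eq: "a = excess \<Longrightarrow> continuous_on {0<..<1} h13 \<and> (\<forall>w\<in>{0<..<1}. 0 < h13 w)"
  shows "exp_decay (\<lambda>t. vine (t *\<^sub>R (x1, x2, x3)))
    (x2 + max a excess + (1 + s1_13) * max 0 (a - excess) + (1 + s2_13) * max 0 (excess - a))"
proof -
  have a: "0 < a" using less S12.s1 by (simp add: a_def)
  have U: "comparable at_top (\<lambda>t. - ln (U t)) (\<lambda>t. exp (- (a * t)))"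
    unfolding U_def a_def by (rule S12.conditional_comparable_greater[OF pos(2) less])
  then have U': "exp_decay (\<lambda>t. - ln (U t)) a"
    by (rule exp_decay_comparable[OF _ exp_decay_exp])
  define r where "r = (1 + s1_13) * max 0 (a - excess) + (1 + s2_13) * max 0 (excess - a) - min a excess"
  have "exp_decay (\<lambda>t. S13.kernel (- ln (U t)) (- ln (W t))) r"
  proof (cases a excess rule: linorder_cases)
    case less
    with S13.kernel_decay_less[OF U' W_decay] a show ?thesis by (simp add: r_def)
  next
    case greater
    with S13.kernel_decay_greater[OF U' W_decay] excess_pos show ?thesis by (simp add: r_def)
  next
    case equal
    obtain \<delta> where d: "0 < \<delta>" "\<delta> < 1" and
      ev: "\<forall>\<^sub>F t in at_top. \<delta> \<le> - ln (W t) / (- ln (U t) + - ln (W t)) \<and>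
        - ln (W t) / (- ln (U t) + - ln (W t)) \<le> 1 - \<delta>"
      using comparable_imp_balanced[OF U W_comparable[folded equal]] by blast
    obtain m M where "0 < m" "\<And>w. \<delta> \<le> w \<Longrightarrow> w \<le> 1 - \<delta> \<Longrightarrow> m \<le> S13.dens w \<and> S13.dens w \<le> M"
      using S13.dens_bounds_compact[OF _ _ d] eq[OF equal] by blast
    from S13.kernel_decay_balanced[OF U' W_decay[folded equal] _ d ev this] a
    have "exp_decay (\<lambda>t. S13.kernel (- ln (U t)) (- ln (W t))) (- a)" by simp
    then show ?thesis by (simp add: r_def equal[symmetric])
  qed
  from vine_decay[OF S12.margin_density_decay_greater[OF pos(2) less] this]
  have "exp_decay (\<lambda>t. vine (t *\<^sub>R (x1, x2, x3))) (x1 + x2 + ((1 + s1_12) * (x1 - x2) - x2) + excess + r)" .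
  moreover have "x1 + x2 + ((1 + s1_12) * (x1 - x2) - x2) = x2 + a"
    by (simp add: a_def algebra_simps)
  moreover have "x2 + a + excess + r = x2 + max a excess + (1 + s1_13) * max 0 (a - excess) + (1 + s2_13) * max 0 (excess - a)"
    by (simp add: r_def max_def min_def)
  ultimately show ?thesis by (simp only:)
qed

end

end

theorem mainTheorem10:
  fixes H12 H23 H13 :: "real measure"
    and h12 h23 h13 :: "real \<Rightarrow> real"
    and V12 V23 V13 :: "real \<Rightarrow> real \<Rightarrow> real"
    and s1_12 s2_12 s1_23 s2_23 s1_13 s2_13 :: real
    and f g :: "real \<times> real \<times> real \<Rightarrow> real"
  assumes spectral_distributions:
      "spectral_distribution H12" "spectral_distribution H23" "spectral_distribution H13"
    and spectral_densities:
      "spectral_density H12 h12" "spectral_density H23 h23" "spectral_density H13 h13"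
    and exponent_measures:
      "V12 = exponent_measure H12" "V23 = exponent_measure H23" "V13 = exponent_measure H13"
    and derivatives:
      "exponent_derivatives_exist V12" "exponent_derivatives_exist V23"
      "exponent_derivatives_exist V13"
    and tails:
      "tail_conditions h12 s1_12 s2_12" "tail_conditions h23 s1_23 s2_23"
      "tail_conditions h13 s1_13 s2_13"
    and f: "f = vine_density (ev_copula V12) (inverted_ev_copula V23) (ev_copula V13)"
    and g_le: "\<And>x1 x2 x3. 0 \<le> x1 \<Longrightarrow> x1 \<le> x2 \<Longrightarrow> 0 \<le> x3 \<Longrightarrow>
      g (x1, x2, x3) = x2 + (1 + s2_12) * (x2 - x1)
        + (2 + s2_13) * (V23 (inverse x2) (inverse x3) - x2)"
    and g_gt: "\<And>x1 x2 x3. 0 \<le> x2 \<Longrightarrow> x2 < x1 \<Longrightarrow> 0 \<le> x3 \<Longrightarrow>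
      g (x1, x2, x3) =
        (let a = (2 + s1_12) * (x1 - x2);
             b = V23 (inverse x2) (inverse x3) - x2;
             sm = (if a \<ge> b then s1_13 else s2_13)
         in x2 + (2 + sm) * max a b - (1 + sm) * min a b)"
  shows "gauge_function_on
    {(x1, x2, x3). 0 < x1 \<and> 0 < x2 \<and> 0 < x3 \<and>
      \<comment> \<open>Only on the two surfaces below do the values of a spectral density away from the
        endpoints matter; there it must not degenerate.\<close>
      (x1 = x2 \<longrightarrow> isCont h12 (1 / 2) \<and> 0 < h12 (1 / 2)) \<and>
      (x2 < x1 \<and> (2 + s1_12) * (x1 - x2) = V23 (inverse x2) (inverse x3) - x2 \<longrightarrow>
        continuous_on {0<..<1} h13 \<and> (\<forall>w\<in>{0<..<1}. 0 < h13 w))}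
    f g"
proof -
  interpret vine_tail H12 H23 H13 h12 h23 h13 s1_12 s2_12 s1_23 s2_23 s1_13 s2_13
    by unfold_locales (use assms in simp_all)
  have V23: "V23 (inverse p) (inverse q) = S23.stdf p q" for p q
    by (simp add: exponent_measures S23.stdf_def)
  define G1 where "G1 x1 x2 x3 = x2 + (1 + s2_12) * (x2 - x1) + (2 + s2_13) * (S23.stdf x2 x3 - x2)"
    for x1 x2 x3
  define G2 where "G2 x1 x2 x3 = x2 + max ((2 + s1_12) * (x1 - x2)) (S23.stdf x2 x3 - x2)
      + (1 + s1_13) * max 0 ((2 + s1_12) * (x1 - x2) - (S23.stdf x2 x3 - x2))
      + (1 + s2_13) * max 0 (S23.stdf x2 x3 - x2 - (2 + s1_12) * (x1 - x2))" for x1 x2 x3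
  have g1: "g (x1, x2, x3) = G1 x1 x2 x3" if "0 \<le> x1" "x1 \<le> x2" "0 \<le> x3" for x1 x2 x3
    using g_le[OF that] by (simp add: G1_def V23)
  have g2: "g (x1, x2, x3) = G2 x1 x2 x3" if "0 \<le> x2" "x2 < x1" "0 \<le> x3" for x1 x2 x3
  proof -
    have alg: "(let sm = (if b \<le> a then s1_13 else s2_13) in x2 + (2 + sm) * max a b - (1 + sm) * min a b)
      = x2 + max a b + (1 + s1_13) * max 0 (a - b) + (1 + s2_13) * max 0 (b - a)" for a b :: real
      by (cases "b \<le> a") (simp_all add: Let_def algebra_simps)
    show ?thesis using g_gt[OF that] unfolding Let_def[of "_ * _"] Let_def[of "_ - _"] alg V23 G2_def .
  qed
  have hom1: "G1 (r * x1) (r * x2) (r * x3) = r * G1 x1 x2 x3" if "0 \<le> r" for r x1 x2 x3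
    unfolding G1_def S23.stdf_homogeneous[OF that] by (simp add: algebra_simps)
  have hom2: "G2 (r * x1) (r * x2) (r * x3) = r * G2 x1 x2 x3" if "0 \<le> r" for r x1 x2 x3
  proof -
    define a b where "a = (2 + s1_12) * (x1 - x2)" and "b = S23.stdf x2 x3 - x2"
    have "(2 + s1_12) * (r * x1 - r * x2) = r * a" "S23.stdf (r * x2) (r * x3) - r * x2 = r * b"
      unfolding S23.stdf_homogeneous[OF that] by (simp_all add: a_def b_def algebra_simps)
    moreover have "max (r * a) (r * b) = r * max a b" "max 0 (r * a - r * b) = r * max 0 (a - b)"
      "max 0 (r * b - r * a) = r * max 0 (b - a)"
      using that by (simp_all add: max_mult_distrib_left[of r] right_diff_distrib)
    ultimately show ?thesis
      unfolding G2_def by (simp only: a_def[symmetric] b_def[symmetric]) (simp add: algebra_simps)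
  qed
  have hom: "g (r *\<^sub>R x) = r * g x" if x: "x \<in> nonneg_orthant" and r: "0 \<le> r" for r x
  proof -
    obtain x1 x2 x3 where [simp]: "x = (x1, x2, x3)" by (cases x)
    have nn: "0 \<le> x1" "0 \<le> x2" "0 \<le> x3" using x by (auto simp: nonneg_orthant_def)
    consider "r = 0" | "0 < r" "x1 \<le> x2" | "0 < r" "x2 < x1" using r by linarith
    then show ?thesis
    proof cases
      case 1
      have "g (0, 0, 0) = 0" using g1[of 0 0 0] hom1[of 0 0 0 0] by simp
      with 1 show ?thesis by (simp add: scaleR_prod_def)
    next
      case 2
      then show ?thesis using nn r g1[of "r * x1" "r * x2" "r * x3"] g1[of x1 x2 x3] hom1[OF r]
        by (simp add: scaleR_prod_def)
    next
      case 3
      then show ?thesis using nn r g2[of "r * x2" "r * x1" "r * x3"] g2[of x2 x1 x3] hom2[OF r]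
        by (simp add: scaleR_prod_def)
    qed
  qed
  have cont_stdf: "continuous_on S (\<lambda>x. S23.stdf (fst (snd x)) (snd (snd x)))"
    for S :: "(real \<times> real \<times> real) set"
    using continuous_on_compose2[OF S23.continuous_stdf, of S "\<lambda>x. (fst (snd x), snd (snd x))"]
    by (simp add: continuous_intros case_prod_beta')
  let ?G1 = "\<lambda>x. G1 (fst x) (fst (snd x)) (snd (snd x))"
  let ?G2 = "\<lambda>x. G2 (fst x) (fst (snd x)) (snd (snd x))"
  have "continuous_on nonneg_orthant (\<lambda>x. if fst x - fst (snd x) \<le> 0 then ?G1 x else ?G2 x)"
  proof (rule continuous_on_cases_le)
    show "continuous_on S ?G1" for S
      unfolding G1_def by (intro continuous_intros cont_stdf)
    show "continuous_on S ?G2" for S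
      unfolding G2_def by (intro continuous_intros cont_stdf)
    show "continuous_on nonneg_orthant (\<lambda>x. fst x - fst (snd x))" by (intro continuous_intros)
    show "?G1 x = ?G2 x" if "fst x - fst (snd x) = 0" for x
      using that S23.stdf_ge_left[of "fst (snd x)" "snd (snd x)"]
      by (simp add: G1_def G2_def max_def algebra_simps)
  qed
  moreover have "(if fst x - fst (snd x) \<le> 0 then ?G1 x else ?G2 x) = g x" if "x \<in> nonneg_orthant" for x
    using that g1[of "fst x" "fst (snd x)" "snd (snd x)"] g2[of "fst (snd x)" "fst x" "snd (snd x)"]
    by (auto simp: nonneg_orthant_def)
  ultimately have cont: "continuous_on nonneg_orthant g"
    by (rule continuous_on_eq)
  have decay: "asymp_equiv (\<lambda>t. - ln (f (t *\<^sub>R (x1, x2, x3)))) at_top (\<lambda>t. t * g (x1, x2, x3))"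
    if pos: "0 < x1" "0 < x2" "0 < x3"
      and diag: "x1 = x2 \<longrightarrow> isCont h12 (1 / 2) \<and> 0 < h12 (1 / 2)"
      and tie: "x2 < x1 \<and> (2 + s1_12) * (x1 - x2) = V23 (inverse x2) (inverse x3) - x2 \<longrightarrow>
        continuous_on {0<..<1} h13 \<and> (\<forall>w\<in>{0<..<1}. 0 < h13 w)" for x1 x2 x3
  proof (rule exp_decay_imp_asymp_equiv)
    have "exp_decay (\<lambda>t. f (t *\<^sub>R (x1, x2, x3))) (g (x1, x2, x3)) \<and> 0 < g (x1, x2, x3)"
    proof (cases "x1 \<le> x2")
      case True
      have "0 < G1 x1 x2 x3"
        unfolding G1_def using pos True S12.s2 S13.s2 excess_pos[OF pos]
        by (intro add_pos_nonneg mult_nonneg_nonneg) auto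
      then show ?thesis
        using vine_decay_le[OF pos True] diag pos True by (simp add: f exponent_measures g1 G1_def)
    next
      case False
      have "0 < G2 x1 x2 x3"
        unfolding G2_def using pos S13.s1 S13.s2 excess_pos[OF pos]
        by (intro add_pos_nonneg mult_nonneg_nonneg) auto
      then show ?thesis
        using vine_decay_gt[OF pos] tie pos False by (simp add: f exponent_measures g2 G2_def V23[unfolded exponent_measures])
    qed
    then show "exp_decay (\<lambda>t. f (t *\<^sub>R (x1, x2, x3))) (g (x1, x2, x3))" "0 < g (x1, x2, x3)"
      by simp_all
  qed
  show ?thesis
    unfolding gauge_function_on_def using cont hom decay by blast
qed

end
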